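(* Let $n\ge2$, let $F$ be a field of characteristic zero and $\delta\in F$ be such that the Brauer algebra $B_n=B_n(\delta)$ over $F$ is semisimple. Then for every partition $\lambda\vdash n$, $$\phi_n(\lambda)=\phi_n(n-2)\,e_\lambda,$$ where $e_\lambda\in\mathbb{Q}\mathfrak{S}_n$ is the primitive central idempotent corresponding to the Specht module $S^\lambda$, viewed as an element of $B_n$.
   Context: The Brauer algebra $B_n(\delta)$ over $F$ has as basis the set $\mathbf{J}_n$ of pair partitions of $\{1,\dots,n\}\cup\{1',\dots,n'\}$, drawn as diagrams with $1,\dots,n$ in the top row and $1',\dots,n'$ in the bottom row. The product of diagrams is $AB=\delta^{v}C$, where $A$ is placed on top of $B$ (identifying the node $i'$ of $A$ with the node $i$ of $B$), $v$ is the number of connected components lying only in the middle row, and $C$ is the diagram given by the connected components of the top and bottom nodes. A propagating line of a diagram is a pair joining a top node and a bottom node. The diagrams with $n$ propagating lines span a subalgebra isomorphic to the group algebra $F\mathfrak{S}_n$; this is how elements of $\mathbb{Q}\mathfrak{S}_n\subset F\mathfrak{S}_n$ are viewed in $B_n$. Let $J_n(n-2)$ be the two-sided ideal spanned by the diagrams with at most $n-2$ propagating lines. $\phi_n(n-2)$ denotes the splitting idempotent of $0\to J_n(n-2)\to B_n\to B_n/J_n(n-2)\to0$, i.e. the unique (central idempotent) element of $B_n$ with $\phi_n(n-2)\equiv1\bmod J_n(n-2)$ and $\phi_n(n-2)J_n(n-2)=J_n(n-2)\phi_n(n-2)=0$. The algebra $B_n$ is cellular with cell modules $\Delta_n(\mu)$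 indexed by partitions $\mu$ of $n,n-2,\dots,0/1$. In the semisimple case these are the simple modules, and $\phi_n(\mu)$ denotes the primitive central idempotent of $B_n$ corresponding to $\Delta_n(\mu)$ (acting as the identity on $\Delta_n(\mu)$ and as zero on the other cell modules). For $\lambda\vdash n$, $\Delta_n(\lambda)$ is the Specht module $S^\lambda$ of $\mathfrak{S}_n$ on which all diagrams with fewer than $n$ propagating lines act as zero. *)

theory Defs
  imports
    Complex_Main
    "HOL-Library.Function_Algebras"
    "HOL-Library.Disjoint_Sets"
    "HOL-Combinatorics.Permutations"
    "HOL-Algebra.Ideal"
begin

definition left_ideal :: "('r, 'm) ring_scheme \<Rightarrow> 'r set \<Rightarrow> bool" where
  "left_ideal R I \<longleftrightarrow>
     additive_subgroup I R \<and> (\<forall>a\<in>carrier R. \<forall>x\<in>I. a \<otimes>\<^bsub>R\<^esub> x \<in> I)"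

text \<open>The left regular module is semisimple: every submodule has a complement.  In a unital
  algebra over a field, left ideals are automatically subspaces.\<close>

definition semisimple_ring :: "('r, 'm) ring_scheme \<Rightarrow> bool" where
  "semisimple_ring R \<longleftrightarrow>
     (\<forall>I. left_ideal R I \<longrightarrow>
        (\<exists>K. left_ideal R K \<and> I \<inter> K = {\<zero>\<^bsub>R\<^esub>} \<and> I <+>\<^bsub>R\<^esub> K = carrier R))"

definition central_idempotent :: "('r, 'm) ring_scheme \<Rightarrow> 'r \<Rightarrow> bool" where
  "central_idempotent R e \<longleftrightarrow>
     e \<in> carrier R \<and> e \<otimes>\<^bsub>R\<^esub> e = e \<and> (\<forall>x\<in>carrier R. e \<otimes>\<^bsub>R\<^esub> x = x \<otimes>\<^bsub>R\<^esub> e)"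

definition primitive_central_idempotent :: "('r, 'm) ring_scheme \<Rightarrow> 'r \<Rightarrow> bool" where
  "primitive_central_idempotent R e \<longleftrightarrow>
     central_idempotent R e \<and> e \<noteq> \<zero>\<^bsub>R\<^esub> \<and>
     (\<forall>f g. central_idempotent R f \<longrightarrow> central_idempotent R g \<longrightarrow>
        f \<otimes>\<^bsub>R\<^esub> g = \<zero>\<^bsub>R\<^esub> \<longrightarrow> e = f \<oplus>\<^bsub>R\<^esub> g \<longrightarrow> f = \<zero>\<^bsub>R\<^esub> \<or> g = \<zero>\<^bsub>R\<^esub>)"

text \<open>Elements are coefficient functions supported on the basis \<open>B\<close>; basis elements multiply by
  \<open>a \<cdot> b = \<gamma> a b (m a b)\<close>, with \<open>\<gamma> a b\<close> a scalar and \<open>m a b\<close> a basis element.\<close>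

definition twisted_algebra ::
    "'b set \<Rightarrow> ('b \<Rightarrow> 'b \<Rightarrow> 'b) \<Rightarrow> ('b \<Rightarrow> 'b \<Rightarrow> 'a::field) \<Rightarrow> 'b \<Rightarrow> ('b \<Rightarrow> 'a) ring" where
  "twisted_algebra B m \<gamma> u =
     \<lparr>carrier = {x. \<forall>b. b \<notin> B \<longrightarrow> x b = 0},
      mult = (\<lambda>x y c. \<Sum>a\<in>B. \<Sum>b\<in>B. if m a b = c then x a * y b * \<gamma> a b else 0),
      one = (\<lambda>b. if b = u then 1 else 0),
      zero = (\<lambda>_. 0),
      add = (\<lambda>x y b. x b + y b)\<rparr>"

definition symmetric_group_algebra :: "nat \<Rightarrow> ((nat \<Rightarrow> nat) \<Rightarrow> 'a::field) ring" where
  "symmetric_group_algebra n = twisted_algebra {\<sigma>. \<sigma> permutes {1..n}} (\<circ>) (\<lambda>_ _. 1) id"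

text \<open>A node is a pair (row, position).  A diagram has top row 0 and bottom row 1; in a picture of
  two stacked diagrams the rows are 0, 1 (the middle row) and 2.\<close>

type_synonym diagram = "(nat \<times> nat) set set"

definition pair_partitions :: "'v set \<Rightarrow> 'v set set set" where
  "pair_partitions V = {d. partition_on V d \<and> (\<forall>p\<in>d. card p = 2)}"

text \<open>Diagrams with \<open>n\<close> top nodes and \<open>m\<close> bottom nodes.  The case \<open>m \<noteq> n\<close> is used for the cell
  modules only.\<close>

definition diagrams :: "nat \<Rightarrow> nat \<Rightarrow> diagram set" where
  "diagrams n m = pair_partitions ({0} \<times> {1..n} \<union> {1} \<times> {1..m})"

definition propagating :: "diagram \<Rightarrow> nat" where
  "propagating d = card {p \<in> d. \<exists>i j. p = {(0, i), (1, j)}}"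

definition stack :: "diagram \<Rightarrow> diagram \<Rightarrow> diagram" where
  "stack a b = a \<union> (\<lambda>p. (\<lambda>(r, i). (Suc r, i)) ` p) ` b"

definition components :: "'v set set \<Rightarrow> 'v set set" where
  "components E = \<Union>E // {(x, y). {x, y} \<in> E}\<^sup>*"

definition loops :: "diagram \<Rightarrow> diagram \<Rightarrow> nat" where
  "loops a b = card {K \<in> components (stack a b). \<forall>(r, i)\<in>K. r = 1}"

text \<open>The outer nodes of each component; the map \<open>r \<mapsto> r div 2\<close> renames row 2 to row 1.\<close>

definition compose_diagrams :: "diagram \<Rightarrow> diagram \<Rightarrow> diagram" where
  "compose_diagrams a b =
     {(\<lambda>(r, i). (r div 2, i)) ` {(r, i) \<in> K. r \<noteq> 1} | K.
        K \<in> components (stack a b) \<and> \<not> (\<forall>(r, i)\<in>K. r = 1)}"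

text \<open>With the bottom node \<open>i\<close> joined to the top node \<open>\<sigma> i\<close>, stacking of diagrams corresponds to
  composition of functions.\<close>

definition perm_diagram :: "nat \<Rightarrow> (nat \<Rightarrow> nat) \<Rightarrow> diagram" where
  "perm_diagram n \<sigma> = (\<lambda>i. {(0, \<sigma> i), (1, i)}) ` {1..n}"

definition brauer_algebra :: "nat \<Rightarrow> 'a::field \<Rightarrow> (diagram \<Rightarrow> 'a) ring" where
  "brauer_algebra n \<delta> =
     twisted_algebra (diagrams n n) compose_diagrams (\<lambda>a b. \<delta> ^ loops a b) (perm_diagram n id)"

definition brauer_ideal :: "nat \<Rightarrow> nat \<Rightarrow> (diagram \<Rightarrow> 'a::field) set" where
  "brauer_ideal n k = {x. \<forall>d. x d \<noteq> 0 \<longrightarrow> d \<in> diagrams n n \<and> propagating d \<le> k}"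

definition embed_perms ::
    "nat \<Rightarrow> ((nat \<Rightarrow> nat) \<Rightarrow> rat) \<Rightarrow> diagram \<Rightarrow> 'a::field_char_0" where
  "embed_perms n x =
     (\<lambda>d. \<Sum>\<sigma> | \<sigma> permutes {1..n} \<and> perm_diagram n \<sigma> = d. of_rat (x \<sigma>))"

text \<open>The conditions determine \<open>\<psi>\<close> uniquely and force it to be a central idempotent.\<close>

definition splitting_idempotent :: "nat \<Rightarrow> 'a::field \<Rightarrow> nat \<Rightarrow> (diagram \<Rightarrow> 'a) \<Rightarrow> bool" where
  "splitting_idempotent n \<delta> k \<psi> \<longleftrightarrow>
     (let B = brauer_algebra n \<delta> in
        \<psi> \<in> carrier B \<and> \<psi> \<ominus>\<^bsub>B\<^esub> \<one>\<^bsub>B\<^esub> \<in> brauer_ideal n k \<and>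
        (\<forall>x\<in>brauer_ideal n k. \<psi> \<otimes>\<^bsub>B\<^esub> x = \<zero>\<^bsub>B\<^esub> \<and> x \<otimes>\<^bsub>B\<^esub> \<psi> = \<zero>\<^bsub>B\<^esub>))"

definition number_partitions :: "nat \<Rightarrow> nat list set" where
  "number_partitions m = {\<mu>. sorted_wrt (\<ge>) \<mu> \<and> 0 \<notin> set \<mu> \<and> sum_list \<mu> = m}"

definition boxes :: "nat list \<Rightarrow> (nat \<times> nat) set" where
  "boxes \<mu> = {(i, j). i < length \<mu> \<and> j < \<mu> ! i}"

definition tableaux :: "nat list \<Rightarrow> (nat \<times> nat \<Rightarrow> nat) set" where
  "tableaux \<mu> = {t. bij_betw t (boxes \<mu>) {1..sum_list \<mu>}}"

text \<open>A tabloid is represented by its sequence of rows, each row being a set.\<close>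

type_synonym tabloid = "nat \<Rightarrow> nat set"

definition tabloid_of :: "nat list \<Rightarrow> (nat \<times> nat \<Rightarrow> nat) \<Rightarrow> tabloid" where
  "tabloid_of \<mu> t = (\<lambda>i. {t (i, j) | j. (i, j) \<in> boxes \<mu>})"

definition column_stabilizer :: "nat list \<Rightarrow> (nat \<times> nat \<Rightarrow> nat) \<Rightarrow> (nat \<Rightarrow> nat) set" where
  "column_stabilizer \<mu> t =
     {\<pi>. \<pi> permutes {1..sum_list \<mu>} \<and>
         (\<forall>(i, j)\<in>boxes \<mu>. \<exists>i'. (i', j) \<in> boxes \<mu> \<and> \<pi> (t (i, j)) = t (i', j))}"

definition polytabloid :: "nat list \<Rightarrow> (nat \<times> nat \<Rightarrow> nat) \<Rightarrow> tabloid \<Rightarrow> 'a::field" where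
  "polytabloid \<mu> t =
     (\<lambda>T. \<Sum>\<pi>\<in>column_stabilizer \<mu> t.
        if tabloid_of \<mu> (\<pi> \<circ> t) = T then of_int (sign \<pi>) else 0)"

definition specht :: "nat list \<Rightarrow> (tabloid \<Rightarrow> 'a::field) set" where
  "specht \<mu> = Modules.module.span (\<lambda>c v T. c * v T) (polytabloid \<mu> ` tableaux \<mu>)"

text \<open>The permutation \<open>\<sigma>\<close> sends the tabloid \<open>T\<close> to \<open>\<lambda>i. \<sigma> ` T i\<close>, hence it sends the function \<open>v\<close>
  to \<open>\<lambda>T. v (\<lambda>i. \<sigma> -` T i)\<close>.\<close>

definition perm_act :: "(nat \<Rightarrow> nat) \<Rightarrow> (tabloid \<Rightarrow> 'a) \<Rightarrow> tabloid \<Rightarrow> 'a" where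
  "perm_act \<sigma> v = (\<lambda>T. v (\<lambda>i. \<sigma> -` T i))"

definition group_algebra_act ::
    "nat \<Rightarrow> ((nat \<Rightarrow> nat) \<Rightarrow> 'a::field) \<Rightarrow> (tabloid \<Rightarrow> 'a) \<Rightarrow> tabloid \<Rightarrow> 'a" where
  "group_algebra_act n x v = (\<lambda>T. \<Sum>\<sigma> | \<sigma> permutes {1..n}. x \<sigma> * perm_act \<sigma> v T)"

definition specht_idempotent :: "nat \<Rightarrow> nat list \<Rightarrow> ((nat \<Rightarrow> nat) \<Rightarrow> rat) \<Rightarrow> bool" where
  "specht_idempotent n \<mu> e \<longleftrightarrow>
     primitive_central_idempotent (symmetric_group_algebra n) e \<and>
     (\<forall>v\<in>specht \<mu>. group_algebra_act n e v = v)"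

text \<open>For a partition \<open>\<mu>\<close> of \<open>k\<close>, the cell module is the tensor product over the group algebra of
  the symmetric group on \<open>{1..k}\<close> of \<open>V\<close> with the Specht module of \<open>\<mu>\<close>.  Here \<open>V\<close> has as basis the
  diagrams with \<open>n\<close> top nodes, \<open>k\<close> bottom nodes and \<open>k\<close> propagating lines.  The Brauer algebra acts
  on \<open>V\<close> by stacking from above, where diagrams with fewer than \<open>k\<close> propagating lines are set to
  zero, and the symmetric group acts by stacking from below.

  The tensor product over the field is \<open>cell_space\<close> (\<open>u d\<close> is the Specht component at the basis
  element \<open>d\<close>), and the cell module is its quotient by \<open>cell_relations\<close>.\<close>

definition cell_basis :: "nat \<Rightarrow> nat \<Rightarrow> diagram set" where
  "cell_basis n k = {d \<in> diagrams n k. propagating d = k}"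

definition cell_space :: "nat \<Rightarrow> nat list \<Rightarrow> (diagram \<Rightarrow> tabloid \<Rightarrow> 'a::field) set" where
  "cell_space n \<mu> =
     {u. (\<forall>d\<in>cell_basis n (sum_list \<mu>). u d \<in> specht \<mu>) \<and>
         (\<forall>d. d \<notin> cell_basis n (sum_list \<mu>) \<longrightarrow> u d = 0)}"

definition pure_tensor :: "diagram \<Rightarrow> (tabloid \<Rightarrow> 'a::field) \<Rightarrow> diagram \<Rightarrow> tabloid \<Rightarrow> 'a" where
  "pure_tensor d v = (\<lambda>c. if c = d then v else 0)"

definition cell_relations :: "nat \<Rightarrow> nat list \<Rightarrow> (diagram \<Rightarrow> tabloid \<Rightarrow> 'a::field) set" where
  "cell_relations n \<mu> = Modules.module.span (\<lambda>c u d T. c * u d T)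
     {pure_tensor (compose_diagrams d (perm_diagram (sum_list \<mu>) \<sigma>)) v - pure_tensor d (perm_act \<sigma> v)
        | d \<sigma> v. d \<in> cell_basis n (sum_list \<mu>) \<and> \<sigma> permutes {1..sum_list \<mu>} \<and> v \<in> specht \<mu>}"

definition cell_act ::
    "nat \<Rightarrow> 'a::field \<Rightarrow> nat list \<Rightarrow> (diagram \<Rightarrow> 'a) \<Rightarrow>
     (diagram \<Rightarrow> tabloid \<Rightarrow> 'a) \<Rightarrow> diagram \<Rightarrow> tabloid \<Rightarrow> 'a" where
  "cell_act n \<delta> \<mu> x u =
     (\<lambda>c T. if c \<in> cell_basis n (sum_list \<mu>)
        then \<Sum>b\<in>diagrams n n. \<Sum>d\<in>cell_basis n (sum_list \<mu>).
               if compose_diagrams b d = c then x b * \<delta> ^ loops b d * u d T else 0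
        else 0)"

definition cell_labels :: "nat \<Rightarrow> nat list set" where
  "cell_labels n = (\<Union>k\<in>{k. k \<le> n \<and> even (n - k)}. number_partitions k)"

definition cell_idempotent :: "nat \<Rightarrow> 'a::field \<Rightarrow> nat list \<Rightarrow> (diagram \<Rightarrow> 'a) \<Rightarrow> bool" where
  "cell_idempotent n \<delta> \<mu> \<phi> \<longleftrightarrow>
     primitive_central_idempotent (brauer_algebra n \<delta>) \<phi> \<and>
     (\<forall>u\<in>cell_space n \<mu>. cell_act n \<delta> \<mu> \<phi> u - u \<in> cell_relations n \<mu>) \<and>
     (\<forall>\<nu>\<in>cell_labels n - {\<mu>}. \<forall>u\<in>cell_space n \<nu>. cell_act n \<delta> \<nu> \<phi> u \<in> cell_relations n \<nu>)"

end

theory Submission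
  imports Defs
begin

text \<open>Write \<open>J\<close> for the ideal spanned by the diagrams that are not permutations.  Modulo \<open>J\<close> the algebra
  is the group algebra, and \<open>\<psi>\<close> kills \<open>J\<close>, so \<open>x \<mapsto> \<psi> x\<close> embeds the group algebra as a corner that
  takes central idempotents to central idempotents.  Hence \<open>G = \<psi> e\<close> is a nonzero central
  idempotent.  By primitivity \<open>\<phi> = G\<close> once \<open>\<phi> G = G\<close>, which means \<open>f e = e\<close> where \<open>f\<close> is the
  image of \<open>\<phi>\<close> modulo \<open>J\<close>.  Now \<open>f\<close> is central in the group algebra and fixes the Specht module,
  because the cell module of a partition of \<open>n\<close> is the Specht module.

  To obtain \<open>f e = e\<close> also over a field larger than the rationals, \<open>e\<close> is made explicit.  A central
  element acts on the Young symmetrizer \<open>y\<close> of a tableau by a scalar, hence by the same scalar on the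
  sum \<open>p\<close> of the conjugates of \<open>y\<close>, and this scalar can be read off from a polytabloid.  So some
  multiple of \<open>p\<close> is a primitive central idempotent that fixes the Specht module, and it equals
  \<open>e\<close>.\<close>

section \<open>Convolution on the symmetric group\<close>

unbundle no m_inv_syntax

text \<open>The main obstacle is the change of field. Primitivity of \<open>e\<close> is known over
  the rationals, whereas \<open>f\<close> has coefficients in the larger field. A priori
  \<open>e\<close> could split there, and \<open>f e\<close> could be a proper part of
  \<open>e\<close> even though \<open>f\<close> fixes the Specht module. The Young symmetrizer has
  integer coefficients, and the argument that central elements act on it by scalars works over every
  field of characteristic zero. So one and the same \<open>p\<close> identifies \<open>e\<close>
  over the rationals and tests \<open>f\<close> over the larger field. Positivity of sums of
  squares, which shows \<open>p p\<close> to be nonzero, is used over the rationals only. The scalar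
  of \<open>f\<close> is 1 because \<open>y\<close> maps the tabloid of the tableau to a nonzero
  multiple of its polytabloid, and \<open>f\<close> fixes the latter.

  On the diagram side, multiplication by a permutation is treated as a relabelling of one row of
  nodes. Relabelling is an isomorphism of the stacked picture, so it leaves the number of loops
  unchanged.\<close>

definition perms :: "nat \<Rightarrow> (nat \<Rightarrow> nat) set" where
  "perms n = {\<sigma>. \<sigma> permutes {1..n}}"

lemma finite_perms [simp]: "finite (perms n)"
  by (simp add: perms_def finite_permutations)

lemma perms_id [simp]: "id \<in> perms n"
  by (simp add: perms_def permutes_id)

lemma perms_pos: "card (perms n) > 0"
  using perms_id[of n] finite_perms[of n] card_gt_0_iff by blast

lemma perms_comp [simp]: "\<sigma> \<in> perms n \<Longrightarrow> \<tau> \<in> perms n \<Longrightarrow> \<sigma> \<circ> \<tau> \<in> perms n"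
  by (simp add: perms_def permutes_compose)

lemma perms_inv [simp]: "\<sigma> \<in> perms n \<Longrightarrow> inv \<sigma> \<in> perms n"
  by (simp add: perms_def permutes_inv)

lemma perms_bij: "\<sigma> \<in> perms n \<Longrightarrow> bij \<sigma>"
  by (simp add: perms_def permutes_bij)

lemma perms_inv_inv [simp]: "\<sigma> \<in> perms n \<Longrightarrow> inv (inv \<sigma>) = \<sigma>"
  by (simp add: perms_bij inv_inv_eq)

lemma perms_inv_left: "\<sigma> \<in> perms n \<Longrightarrow> inv \<sigma> \<circ> \<sigma> = id"
  by (simp add: perms_def permutes_inv_o)

lemma perms_inv_right: "\<sigma> \<in> perms n \<Longrightarrow> \<sigma> \<circ> inv \<sigma> = id"
  by (simp add: perms_def permutes_inv_o)

lemma perms_inv_cancel [simp]: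
  assumes "\<sigma> \<in> perms n"
  shows "inv \<sigma> \<circ> (\<sigma> \<circ> f) = f" "\<sigma> \<circ> (inv \<sigma> \<circ> f) = f"
  using assms by (simp_all add: comp_assoc[symmetric] perms_inv_left perms_inv_right)

lemma perms_inv_apply [simp]:
  assumes "\<sigma> \<in> perms n"
  shows "inv \<sigma> (\<sigma> i) = i" "\<sigma> (inv \<sigma> i) = i"
  using fun_cong[OF perms_inv_left[OF assms]] fun_cong[OF perms_inv_right[OF assms]] by auto

lemma inv_comp_perms: "\<sigma> \<in> perms n \<Longrightarrow> \<tau> \<in> perms n \<Longrightarrow> inv (\<sigma> \<circ> \<tau>) = inv \<tau> \<circ> inv \<sigma>"
  by (simp add: perms_bij o_inv_distrib)

lemma sum_perms_left: "\<tau> \<in> perms n \<Longrightarrow> sum g (perms n) = (\<Sum>\<sigma>\<in>perms n. g (\<tau> \<circ> \<sigma>))"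
  using setum_permutations_compose_left[of \<tau> "{1..n}" g] by (simp add: perms_def)

lemma sum_perms_right: "\<tau> \<in> perms n \<Longrightarrow> sum g (perms n) = (\<Sum>\<sigma>\<in>perms n. g (\<sigma> \<circ> \<tau>))"
  using sum_permutations_compose_right[of \<tau> "{1..n}" g] by (simp add: perms_def)

lemma sum_perms_inv: "sum g (perms n) = (\<Sum>\<sigma>\<in>perms n. g (inv \<sigma>))"
  using sum_permutations_inverse[of g "{1..n}"] by (simp add: perms_def)

text \<open>The group algebra acts on functions on any set acted on by the symmetric group;
  convolution is the case of the left regular action.\<close>

definition lin_act ::
    "nat \<Rightarrow> ((nat \<Rightarrow> nat) \<Rightarrow> 'd \<Rightarrow> 'd) \<Rightarrow> ((nat \<Rightarrow> nat) \<Rightarrow> 'k::field) \<Rightarrow> ('d \<Rightarrow> 'k) \<Rightarrow> 'd \<Rightarrow> 'k" where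
  "lin_act n act x v = (\<lambda>d. \<Sum>\<sigma>\<in>perms n. x \<sigma> * v (act (inv \<sigma>) d))"

abbreviation conv ::
    "nat \<Rightarrow> ((nat \<Rightarrow> nat) \<Rightarrow> 'k::field) \<Rightarrow> ((nat \<Rightarrow> nat) \<Rightarrow> 'k) \<Rightarrow> (nat \<Rightarrow> nat) \<Rightarrow> 'k" where
  "conv n \<equiv> lin_act n (\<circ>)"

text \<open>Only values at permutations are constrained. The coefficient function
  \<open>\<lambda>\<sigma>. \<phi> (perm_diagram n \<sigma>)\<close>, to which this is applied
  later, need not vanish outside \<open>perms n\<close>, because
  \<open>perm_diagram n \<sigma>\<close> looks at \<open>\<sigma>\<close> on \<open>{1..n}\<close>
  only.\<close>

definition class_fun :: "nat \<Rightarrow> ((nat \<Rightarrow> nat) \<Rightarrow> 'k) \<Rightarrow> bool" where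
  "class_fun n z \<longleftrightarrow> (\<forall>\<sigma>\<in>perms n. \<forall>\<tau>\<in>perms n. z (\<sigma> \<circ> \<tau>) = z (\<tau> \<circ> \<sigma>))"

lemma lin_act_cong: "(\<And>\<sigma>. \<sigma> \<in> perms n \<Longrightarrow> x \<sigma> = x' \<sigma>) \<Longrightarrow> lin_act n act x v = lin_act n act x' v"
  by (simp add: lin_act_def)

lemma lin_act_conv:
  assumes "\<And>\<sigma> \<tau>. \<sigma> \<in> perms n \<Longrightarrow> \<tau> \<in> perms n \<Longrightarrow> act (\<sigma> \<circ> \<tau>) = act \<sigma> \<circ> act \<tau>"
  shows "lin_act n act (conv n x y) v = lin_act n act x (lin_act n act y v)"
proof
  fix d
  have "lin_act n act (conv n x y) v d =
      (\<Sum>\<sigma>\<in>perms n. \<Sum>\<rho>\<in>perms n. x \<sigma> * y (inv \<sigma> \<circ> \<rho>) * v (act (inv \<rho>) d))"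
    unfolding lin_act_def by (simp add: sum_distrib_right) (rule sum.swap)
  also have "\<dots> = (\<Sum>\<sigma>\<in>perms n. \<Sum>\<rho>\<in>perms n. x \<sigma> * y \<rho> * v (act (inv \<rho>) (act (inv \<sigma>) d)))"
  proof (rule sum.cong[OF refl])
    fix \<sigma> assume s: "\<sigma> \<in> perms n"
    show "(\<Sum>\<rho>\<in>perms n. x \<sigma> * y (inv \<sigma> \<circ> \<rho>) * v (act (inv \<rho>) d)) =
        (\<Sum>\<rho>\<in>perms n. x \<sigma> * y \<rho> * v (act (inv \<rho>) (act (inv \<sigma>) d)))"
      by (subst sum_perms_left[OF s], rule sum.cong) (simp_all add: s inv_comp_perms[OF s] assms perms_inv_cancel[OF s])
  qed
  also have "\<dots> = lin_act n act x (lin_act n act y v) d"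
    unfolding lin_act_def by (simp add: sum_distrib_left mult.assoc)
  finally show "lin_act n act (conv n x y) v d = lin_act n act x (lin_act n act y v) d" .
qed

lemma conv_assoc: "conv n (conv n x y) z = conv n x (conv n y z)"
  by (rule lin_act_conv) (simp add: fun_eq_iff)

text \<open>Replacing the summation variable \<open>\<sigma>\<close> by
  \<open>\<rho> \<circ> inv \<sigma>\<close> exchanges the two factors, up to the order of the
  arguments of \<open>z\<close>. The restriction to \<open>\<rho>\<close> in \<open>perms n\<close>
  is there because no support condition is put on \<open>x\<close> and \<open>z\<close>.\<close>

lemma conv_class_fun_commute:
  assumes "class_fun n z" "\<rho> \<in> perms n"
  shows "conv n z x \<rho> = conv n x z \<rho>"
proof -
  have "conv n z x \<rho> = (\<Sum>\<sigma>\<in>perms n. z (\<rho> \<circ> inv \<sigma>) * x (inv (\<rho> \<circ> inv \<sigma>) \<circ> \<rho>))"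
    unfolding lin_act_def
    by (subst sum_perms_left[OF assms(2)], subst sum_perms_inv) simp
  also have "\<dots> = conv n x z \<rho>"
    unfolding lin_act_def
  proof (rule sum.cong[OF refl])
    fix \<sigma> assume s: "\<sigma> \<in> perms n"
    have "inv (\<rho> \<circ> inv \<sigma>) \<circ> \<rho> = \<sigma>"
      using s assms(2) by (simp add: inv_comp_perms comp_assoc perms_inv_left)
    moreover have "z (\<rho> \<circ> inv \<sigma>) = z (inv \<sigma> \<circ> \<rho>)"
      using assms s unfolding class_fun_def by simp
    ultimately show "z (\<rho> \<circ> inv \<sigma>) * x (inv (\<rho> \<circ> inv \<sigma>) \<circ> \<rho>) = x \<sigma> * z (inv \<sigma> \<circ> \<rho>)"
      by simp
  qed
  finally show ?thesis .
qed

lemma lin_act_scale: "lin_act n act x (\<lambda>d. c * v d) = (\<lambda>d. c * lin_act n act x v d)"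
  by (simp add: lin_act_def sum_distrib_left mult.left_commute)

lemma lin_act_scale_left: "lin_act n act (\<lambda>\<sigma>. c * x \<sigma>) v = (\<lambda>d. c * lin_act n act x v d)"
  by (simp add: lin_act_def sum_distrib_left mult.assoc)

lemma lin_act_add: "lin_act n act x (\<lambda>d. v d + w d) = (\<lambda>d. lin_act n act x v d + lin_act n act x w d)"
  by (simp add: lin_act_def sum.distrib distrib_left)

lemma lin_act_zero: "lin_act n act x (\<lambda>_. 0) = (\<lambda>_. 0)"
  by (simp add: lin_act_def)

lemma of_rat_conv:
  "of_rat (conv n x y \<sigma>) = conv n (\<lambda>\<sigma>. of_rat (x \<sigma>)) (\<lambda>\<sigma>. of_rat (y \<sigma>) :: 'k::field_char_0) \<sigma>"
  by (simp add: lin_act_def of_rat_sum of_rat_mult)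

text \<open>For a fixed left factor \<open>a\<close> the only \<open>b\<close> with
  \<open>a \<circ> b = c\<close> is \<open>inv a \<circ> c\<close>; if this is not a permutation in
  \<open>perms n\<close>, then \<open>y\<close> vanishes there.\<close>

lemma symmetric_group_algebra_mult:
  assumes "y \<in> carrier (symmetric_group_algebra n)"
  shows "x \<otimes>\<^bsub>symmetric_group_algebra n\<^esub> y = conv n x y"
proof
  fix c
  have *: "(\<Sum>b\<in>perms n. if a \<circ> b = c then x a * y b else 0) = x a * y (inv a \<circ> c)"
    if a: "a \<in> perms n" for a
  proof -
    have "(a \<circ> b = c) = (inv a \<circ> c = b)" if "b \<in> perms n" for b
      using a by auto
    then have "(\<Sum>b\<in>perms n. if a \<circ> b = c then x a * y b else 0) =
        (\<Sum>b\<in>perms n. if inv a \<circ> c = b then x a * y b else 0)"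
      by (intro sum.cong) auto
    also have "\<dots> = (if inv a \<circ> c \<in> perms n then x a * y (inv a \<circ> c) else 0)"
      by (simp add: sum.delta)
    also have "\<dots> = x a * y (inv a \<circ> c)"
      using assms by (simp add: symmetric_group_algebra_def twisted_algebra_def perms_def)
    finally show ?thesis .
  qed
  show "(x \<otimes>\<^bsub>symmetric_group_algebra n\<^esub> y) c = conv n x y c"
    unfolding lin_act_def symmetric_group_algebra_def twisted_algebra_def perms_def[symmetric]
    by (simp add: * cong: if_cong)
qed

definition single :: "'d \<Rightarrow> 'd \<Rightarrow> 'k::zero_neq_one" where
  "single a = (\<lambda>b. if b = a then 1 else 0)"

section \<open>Young symmetrizers\<close>

lemma initial_segment_card:
  fixes D :: "nat set"
  assumes "finite D" "\<And>i k. i \<in> D \<Longrightarrow> k \<le> i \<Longrightarrow> k \<in> D"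
  shows "D = {..<card D}"
proof (cases "D = {}")
  case False
  have "D = {..Max D}"
    using assms False by (auto intro: Max_ge assms(2)[OF Max_in])
  then have "D = {..<Suc (Max D)}"
    by (simp add: lessThan_Suc_atMost)
  then show ?thesis
    by (metis card_lessThan)
qed simp

text \<open>The largest element of a finite set of naturals is at least the number of the other
  elements, and induction on it gives both claims. The equality case is what counts: it later forces
  the entries of a column to occupy exactly the boxes of that column.\<close>

lemma sum_ge_initial_segment:
  fixes A :: "nat set"
  assumes "finite A"
  shows "\<Sum>{..<card A} \<le> \<Sum>A \<and> (\<Sum>A = \<Sum>{..<card A} \<longrightarrow> A = {..<card A})"
  using assms
proof (induction A rule: finite_linorder_max_induct)
  case (insert b A)
  have "A \<subseteq> {..<b}"
    using insert.hyps by auto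
  then have "card A \<le> b"
    using card_mono[of "{..<b}" A] by simp
  have notin: "b \<notin> A"
    using insert.hyps by auto
  then have sums: "\<Sum>(insert b A) = b + \<Sum>A" "\<Sum>{..<card (insert b A)} = \<Sum>{..<card A} + card A"
    using insert.hyps by simp_all
  show ?case
  proof (intro conjI impI)
    show "\<Sum>{..<card (insert b A)} \<le> \<Sum>(insert b A)"
      unfolding sums using insert.IH \<open>card A \<le> b\<close> by linarith
    assume "\<Sum>(insert b A) = \<Sum>{..<card (insert b A)}"
    then have "b = card A" "A = {..<card A}"
      unfolding sums using insert.IH \<open>card A \<le> b\<close> by linarith+
    then show "insert b A = {..<card (insert b A)}"
      using notin insert.hyps by (metis card_insert_disjoint lessThan_Suc)
  qed
qed simp

section \<open>Tabloids and the stabilizers of a tableau\<close>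

definition tabloid_act :: "(nat \<Rightarrow> nat) \<Rightarrow> tabloid \<Rightarrow> tabloid" where
  "tabloid_act \<sigma> T = (\<lambda>i. \<sigma> ` T i)"

lemma tabloid_act_comp: "tabloid_act (\<sigma> \<circ> \<tau>) = tabloid_act \<sigma> \<circ> tabloid_act \<tau>"
  by (simp add: tabloid_act_def fun_eq_iff image_comp)

lemma group_algebra_act_eq_lin_act: "group_algebra_act n x v = lin_act n tabloid_act x v"
  unfolding group_algebra_act_def lin_act_def perm_act_def tabloid_act_def perms_def[symmetric]
  by (intro ext sum.cong refl) (simp add: bij_vimage_eq_inv_image perms_bij)

lemma tabloid_of_comp: "tabloid_of \<mu> (\<sigma> \<circ> t) = tabloid_act \<sigma> (tabloid_of \<mu> t)"
  by (auto simp: tabloid_of_def tabloid_act_def fun_eq_iff)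

lemma tabloid_act_inv_iff:
  assumes "\<sigma> \<in> perms n"
  shows "tabloid_act (inv \<sigma>) T = T' \<longleftrightarrow> T = tabloid_act \<sigma> T'"
proof -
  have "tabloid_act \<sigma> (tabloid_act (inv \<sigma>) T) = T" "tabloid_act (inv \<sigma>) (tabloid_act \<sigma> T') = T'"
    using assms by (simp_all add: tabloid_act_def image_image)
  then show ?thesis
    by auto
qed

locale young_tableau =
  fixes \<mu> :: "nat list" and t :: "nat \<times> nat \<Rightarrow> nat" and n :: nat
  assumes number_partition: "\<mu> \<in> number_partitions n" and tableau: "t \<in> tableaux \<mu>"
begin

lemma sum_list_eq: "sum_list \<mu> = n"
  using number_partition by (simp add: number_partitions_def)

lemma bij_tableau: "bij_betw t (boxes \<mu>) {1..n}"
  using tableau by (simp add: tableaux_def sum_list_eq)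

lemma boxes_down: "(i, j) \<in> boxes \<mu> \<Longrightarrow> k \<le> i \<Longrightarrow> (k, j) \<in> boxes \<mu>"
  using number_partition unfolding number_partitions_def boxes_def
  by (cases "k = i") (auto simp: sorted_wrt_iff_nth_less intro: less_le_trans)

definition row :: "nat \<Rightarrow> nat" where "row x = fst (inv_into (boxes \<mu>) t x)"
definition col :: "nat \<Rightarrow> nat" where "col x = snd (inv_into (boxes \<mu>) t x)"

lemma row_col:
  assumes "x \<in> {1..n}"
  shows "(row x, col x) \<in> boxes \<mu>" "t (row x, col x) = x"
  using bij_tableau assms inv_into_into[of x t "boxes \<mu>"] f_inv_into_f[of x t "boxes \<mu>"]
  by (simp_all add: row_def col_def bij_betw_def)

lemma row_t [simp]: "(i, j) \<in> boxes \<mu> \<Longrightarrow> row (t (i, j)) = i"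
  and col_t [simp]: "(i, j) \<in> boxes \<mu> \<Longrightarrow> col (t (i, j)) = j"
  using bij_tableau by (simp_all add: row_def col_def bij_betw_def)

lemma t_in: "(i, j) \<in> boxes \<mu> \<Longrightarrow> t (i, j) \<in> {1..n}"
  using bij_tableau bij_betwE by blast

lemma row_col_inject: "x \<in> {1..n} \<Longrightarrow> y \<in> {1..n} \<Longrightarrow> row x = row y \<Longrightarrow> col x = col y \<Longrightarrow> x = y"
  by (metis row_col(2))

definition C :: "(nat \<Rightarrow> nat) set" where
  "C = {\<pi> \<in> perms n. \<forall>x\<in>{1..n}. col (\<pi> x) = col x}"
definition R :: "(nat \<Rightarrow> nat) set" where
  "R = {\<pi> \<in> perms n. \<forall>x\<in>{1..n}. row (\<pi> x) = row x}"

lemma perms_in: "\<sigma> \<in> perms n \<Longrightarrow> x \<in> {1..n} \<Longrightarrow> \<sigma> x \<in> {1..n}"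
  using permutes_in_image[of \<sigma> "{1..n}" x] by (simp add: perms_def)

lemma C_perms: "\<pi> \<in> C \<Longrightarrow> \<pi> \<in> perms n"
  and R_perms: "\<pi> \<in> R \<Longrightarrow> \<pi> \<in> perms n"
  by (simp_all add: C_def R_def)

lemma C_comp: "\<pi> \<in> C \<Longrightarrow> \<pi>' \<in> C \<Longrightarrow> \<pi> \<circ> \<pi>' \<in> C"
  and R_comp: "\<pi> \<in> R \<Longrightarrow> \<pi>' \<in> R \<Longrightarrow> \<pi> \<circ> \<pi>' \<in> R"
  unfolding C_def R_def using perms_in[of \<pi>'] perms_comp[of \<pi> n \<pi>'] by auto

lemma C_inv: "\<pi> \<in> C \<Longrightarrow> inv \<pi> \<in> C"
  and R_inv: "\<pi> \<in> R \<Longrightarrow> inv \<pi> \<in> R"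
proof -
  have "f (inv \<pi> x) = f x" if "\<pi> \<in> perms n" "\<forall>x\<in>{1..n}. f (\<pi> x) = f x" "x \<in> {1..n}" for f :: "nat \<Rightarrow> nat" and x
    using bspec[OF that(2) perms_in[OF perms_inv[OF that(1)] that(3)]] that(1) by simp
  then show "\<pi> \<in> C \<Longrightarrow> inv \<pi> \<in> C" "\<pi> \<in> R \<Longrightarrow> inv \<pi> \<in> R"
    unfolding C_def R_def using perms_inv[of \<pi> n] by blast+
qed

lemma C_comp_iff: "\<pi> \<in> C \<Longrightarrow> \<sigma> \<circ> \<pi> \<in> C \<longleftrightarrow> \<sigma> \<in> C"
proof
  assume "\<pi> \<in> C" "\<sigma> \<circ> \<pi> \<in> C"
  then have "(\<sigma> \<circ> \<pi>) \<circ> inv \<pi> \<in> C"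
    using C_comp C_inv by blast
  with \<open>\<pi> \<in> C\<close> show "\<sigma> \<in> C"
    by (simp add: comp_assoc perms_inv_right[OF C_perms])
qed (auto intro: C_comp)

lemma R_comp_iff: "\<pi> \<in> R \<Longrightarrow> \<pi> \<circ> \<sigma> \<in> R \<longleftrightarrow> \<sigma> \<in> R"
proof
  assume "\<pi> \<in> R" "\<pi> \<circ> \<sigma> \<in> R"
  then have "inv \<pi> \<circ> (\<pi> \<circ> \<sigma>) \<in> R"
    using R_comp R_inv by blast
  with \<open>\<pi> \<in> R\<close> show "\<sigma> \<in> R"
    by (simp add: perms_inv_cancel[OF R_perms])
qed (auto intro: R_comp)

lemma C_Int_R: "\<pi> \<in> C \<Longrightarrow> \<pi> \<in> R \<Longrightarrow> \<pi> = id"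
proof
  fix x assume *: "\<pi> \<in> C" "\<pi> \<in> R"
  show "\<pi> x = id x"
  proof (cases "x \<in> {1..n}")
    case True
    then show ?thesis
      using row_col_inject[of "\<pi> x" x] perms_in[of \<pi> x] * by (auto simp: C_def R_def)
  next
    case False
    then show ?thesis
      using * by (auto simp: C_def perms_def permutes_def)
  qed
qed

lemma column_stabilizer_eq: "column_stabilizer \<mu> t = C"
proof -
  have "(\<forall>(i, j)\<in>boxes \<mu>. \<exists>i'. (i', j) \<in> boxes \<mu> \<and> \<pi> (t (i, j)) = t (i', j)) \<longleftrightarrow>
      (\<forall>x\<in>{1..n}. col (\<pi> x) = col x)" (is "?l \<longleftrightarrow> ?r") if p: "\<pi> \<in> perms n" for \<pi>
  proof
    assume l: ?l
    show ?r
    proof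
      fix x assume x: "x \<in> {1..n}"
      obtain i' where "(i', col x) \<in> boxes \<mu>" "\<pi> (t (row x, col x)) = t (i', col x)"
        using bspec[OF l row_col(1)[OF x]] by auto
      then show "col (\<pi> x) = col x"
        by (simp add: row_col(2)[OF x])
    qed
  next
    assume r: ?r
    show ?l
    proof clarify
      fix i j assume b: "(i, j) \<in> boxes \<mu>"
      then have "t (i, j) \<in> {1..n}"
        by (rule t_in)
      with r b have "col (\<pi> (t (i, j))) = j" "\<pi> (t (i, j)) \<in> {1..n}"
        using perms_in[OF p] by auto
      then show "\<exists>i'. (i', j) \<in> boxes \<mu> \<and> \<pi> (t (i, j)) = t (i', j)"
        using row_col[of "\<pi> (t (i, j))"] by metis
    qed
  qed
  from this[unfolded perms_def mem_Collect_eq] show ?thesis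
    unfolding column_stabilizer_def C_def sum_list_eq perms_def mem_Collect_eq
    by (intro Collect_cong conj_cong refl)
qed

lemma tabloid_of_eq: "tabloid_of \<mu> t i = {x \<in> {1..n}. row x = i}"
proof -
  have "x \<in> tabloid_of \<mu> t i \<longleftrightarrow> x \<in> {1..n} \<and> row x = i" for x
    unfolding tabloid_of_def using t_in row_col[of x] by (auto intro!: exI[of _ "col x"])
  then show ?thesis
    by auto
qed

lemma tabloid_act_fix:
  assumes "\<sigma> \<in> perms n"
  shows "tabloid_act \<sigma> (tabloid_of \<mu> t) = tabloid_of \<mu> t \<longleftrightarrow> \<sigma> \<in> R"
proof
  assume eq: "tabloid_act \<sigma> (tabloid_of \<mu> t) = tabloid_of \<mu> t"
  have "row (\<sigma> x) = row x" if "x \<in> {1..n}" for x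
  proof -
    have "\<sigma> x \<in> tabloid_act \<sigma> (tabloid_of \<mu> t) (row x)"
      using that by (simp add: tabloid_act_def tabloid_of_eq)
    then show ?thesis
      by (simp add: eq tabloid_of_eq)
  qed
  with assms show "\<sigma> \<in> R"
    by (simp add: R_def)
next
  assume s: "\<sigma> \<in> R"
  show "tabloid_act \<sigma> (tabloid_of \<mu> t) = tabloid_of \<mu> t"
  proof (rule ext, rule Set.set_eqI)
    fix i x :: nat
    have "x \<in> {1..n} \<and> row x = i \<longleftrightarrow> inv \<sigma> x \<in> {1..n} \<and> row (inv \<sigma> x) = i"
    proof -
      have "inv \<sigma> x \<in> {1..n} \<longleftrightarrow> x \<in> {1..n}"
        using permutes_in_image[of "inv \<sigma>" "{1..n}" x] perms_inv[OF assms] by (simp add: perms_def)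
      moreover have "row (inv \<sigma> x) = row x" if "x \<in> {1..n}"
        using R_inv[OF s] that by (simp add: R_def)
      ultimately show ?thesis
        by (intro conj_cong) simp_all
    qed
    moreover have "x \<in> \<sigma> ` A \<longleftrightarrow> inv \<sigma> x \<in> A" for A
      using assms by (auto simp: image_iff intro!: bexI[of _ "inv \<sigma> x"])
    ultimately show "x \<in> tabloid_act \<sigma> (tabloid_of \<mu> t) i \<longleftrightarrow> x \<in> tabloid_of \<mu> t i"
      by (simp add: tabloid_act_def tabloid_of_eq)
  qed
qed

text \<open>In the tableau \<open>z \<circ> t\<close> the entry \<open>x\<close> lies in row
  \<open>inv z x\<close> of \<open>t\<close>, so the hypothesis says that no two entries of one
  column of \<open>t\<close> share a row of \<open>z \<circ> t\<close>. Then \<open>z\<close> is an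
  element of \<open>C\<close> times an element of \<open>R\<close>. Instead of sorting the columns
  row by row, the proof compares sums of row indices: distinct indices in a column sum to at least
  those of an initial segment, and the totals over all columns agree.\<close>

lemma factor_through_stabilizers:
  assumes z: "z \<in> perms n"
    and distinct: "\<And>x y. x \<in> {1..n} \<Longrightarrow> y \<in> {1..n} \<Longrightarrow> col x = col y \<Longrightarrow>
      row (inv z x) = row (inv z y) \<Longrightarrow> x = y"
  obtains q where "q \<in> C" "q \<circ> z \<in> R"
proof -
  define row' where "row' x = row (inv z x)" for x
  define col_set where "col_set j = {x \<in> {1..n}. col x = j}" for j
  have inj': "inj_on row' (col_set j)" for j
    by (rule inj_onI, rule distinct) (simp_all add: row'_def col_set_def)
  have inj: "inj_on row (col_set j)" for j
    by (rule inj_onI, rule row_col_inject) (simp_all add: col_set_def)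
  have segment: "row ` col_set j = {..<card (col_set j)}" for j
  proof -
    have "k \<in> row ` col_set j" if "i \<in> row ` col_set j" "k \<le> i" for i k
    proof -
      from that obtain x where x: "x \<in> {1..n}" "col x = j" "i = row x"
        by (auto simp: col_set_def)
      then have b: "(k, j) \<in> boxes \<mu>"
        using boxes_down[of i j k] row_col(1)[of x] that by simp
      then have "t (k, j) \<in> col_set j" "row (t (k, j)) = k"
        using t_in[OF b] by (auto simp: col_set_def)
      then show ?thesis
        by (metis imageI)
    qed
    then have "row ` col_set j = {..<card (row ` col_set j)}"
      by (intro initial_segment_card) (auto simp: col_set_def)
    then show ?thesis
      by (simp add: card_image[OF inj])
  qed
  have sums: "sum row (col_set j) = \<Sum>{..<card (col_set j)}"
      "sum row' (col_set j) = \<Sum>(row' ` col_set j)" for j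
    using sum.reindex[OF inj, of "\<lambda>x. x" j] sum.reindex[OF inj', of "\<lambda>x. x" j]
    by (simp_all add: segment)
  have minimal: "\<Sum>{..<card (col_set j)} \<le> \<Sum>(row' ` col_set j) \<and>
      (\<Sum>(row' ` col_set j) = \<Sum>{..<card (col_set j)} \<longrightarrow> row' ` col_set j = {..<card (col_set j)})" for j
    using sum_ge_initial_segment[of "row' ` col_set j"] unfolding card_image[OF inj']
    by (simp add: col_set_def)
  have ge: "sum row (col_set j) \<le> sum row' (col_set j)"
    and eq: "sum row' (col_set j) = sum row (col_set j) \<Longrightarrow> row' ` col_set j = row ` col_set j" for j
    unfolding sums segment using minimal by blast+
  have columns: "sum f {1..n} = (\<Sum>j\<in>col ` {1..n}. sum f (col_set j))" for f :: "nat \<Rightarrow> nat"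
    unfolding col_set_def by (rule sum.image_gen) simp
  \<comment> \<open>Both totals agree because \<open>inv z\<close> permutes \<open>{1..n}\<close>.
    The columnwise inequalities \<open>ge\<close> must then all be equalities, and the uniqueness of
    the minimizer determines the image of every column.\<close>
  have "sum row' {1..n} = sum row {1..n}"
    unfolding row'_def
    using sum.permute[of "inv z" "{1..n}" row] perms_inv[OF z] by (simp add: perms_def o_def)
  then have "sum row (col_set j) = sum row' (col_set j)" if "j \<in> col ` {1..n}" for j
    using sum_mono_inv[of "\<lambda>j. sum row (col_set j)" "col ` {1..n}" "\<lambda>j. sum row' (col_set j)" j]
      ge that columns[of row] columns[of row'] by simp
  then have image: "row' ` col_set j = row ` col_set j" if "j \<in> col ` {1..n}" for j
    using eq that by simp
  have box: "(row' x, col x) \<in> boxes \<mu>" if x: "x \<in> {1..n}" for x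
  proof -
    have "row' x \<in> row' ` col_set (col x)"
      using x by (simp add: col_set_def)
    then obtain x' where "x' \<in> col_set (col x)" "row' x = row x'"
      using image[of "col x"] x by auto
    then show ?thesis
      using row_col(1)[of x'] by (simp add: col_set_def)
  qed
  \<comment> \<open>\<open>q\<close> keeps each entry in its column of \<open>t\<close> and moves it
    to the row that it has in \<open>z \<circ> t\<close>.\<close>
  define q where "q x = (if x \<in> {1..n} then t (row' x, col x) else x)" for x
  have q_in: "q x \<in> {1..n}" and q_row: "row (q x) = row' x" and q_col: "col (q x) = col x"
    if "x \<in> {1..n}" for x
    using that box t_in by (auto simp: q_def)
  have "inj_on q {1..n}"
  proof (rule inj_onI)
    fix x y assume "x \<in> {1..n}" "y \<in> {1..n}" "q x = q y"
    then show "x = y"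
      using q_row[of x] q_row[of y] q_col[of x] q_col[of y] distinct[of x y] by (simp add: row'_def)
  qed
  then have "bij_betw q {1..n} {1..n}"
    using q_in by (intro bij_betw_imageI endo_inj_surj) auto
  then have "q permutes {1..n}"
    by (rule bij_imp_permutes) (auto simp: q_def)
  then have q: "q \<in> C"
    using q_col by (simp add: C_def perms_def)
  \<comment> \<open>At the argument \<open>z x\<close> the value of \<open>row'\<close> is
    \<open>row x\<close>.\<close>
  moreover have "q \<circ> z \<in> R"
    using q_row perms_in[OF z] z C_perms[OF q] unfolding R_def row'_def by auto
  ultimately show ?thesis
    using that by blast
qed

section \<open>The Young symmetrizer and the action of central elements on it\<close>

definition column_antisymmetrizer :: "(nat \<Rightarrow> nat) \<Rightarrow> 'k::field" where
  "column_antisymmetrizer \<pi> = (if \<pi> \<in> C then of_int (sign \<pi>) else 0)"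

definition row_symmetrizer :: "(nat \<Rightarrow> nat) \<Rightarrow> 'k::field" where
  "row_symmetrizer \<pi> = (if \<pi> \<in> R then 1 else 0)"

text \<open>The column factor stands on the left, so that applying the symmetrizer to the tabloid of
  \<open>t\<close> first symmetrizes rows and then produces a multiple of the polytabloid.\<close>

definition young_symmetrizer :: "(nat \<Rightarrow> nat) \<Rightarrow> 'k::field" where
  "young_symmetrizer = conv n column_antisymmetrizer row_symmetrizer"

lemma sign_comp_perms: "\<sigma> \<in> perms n \<Longrightarrow> \<tau> \<in> perms n \<Longrightarrow> sign (\<sigma> \<circ> \<tau>) = sign \<sigma> * sign \<tau>"
  by (intro sign_compose permutes_imp_permutation[of "{1..n}"]) (simp_all add: perms_def)

lemma column_antisymmetrizer_comp:
  "\<pi> \<in> C \<Longrightarrow> \<sigma> \<in> perms n \<Longrightarrow>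
    column_antisymmetrizer (\<sigma> \<circ> \<pi>) = of_int (sign \<pi>) * column_antisymmetrizer \<sigma>"
  by (simp add: column_antisymmetrizer_def C_comp_iff sign_comp_perms C_perms)

lemma row_symmetrizer_comp: "\<pi> \<in> R \<Longrightarrow> row_symmetrizer (\<pi> \<circ> \<sigma>) = row_symmetrizer \<sigma>"
  by (simp add: row_symmetrizer_def R_comp_iff)

text \<open>Let \<open>a\<close> be the column antisymmetrizer and \<open>b\<close> the row
  symmetrizer; the sum is the coefficient of \<open>a z b\<close> at \<open>\<sigma>\<close>. If
  \<open>q \<circ> z\<close> lies in \<open>R\<close> for some \<open>q\<close> in \<open>C\<close>,
  then \<open>a z b = a (inv q) (q z) b\<close>, which is \<open>sign q\<close> times
  \<open>a b\<close>. Otherwise two entries share a column of \<open>t\<close> and a row of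
  \<open>z \<circ> t\<close>. Their transposition \<open>s\<close> satisfies
  \<open>a s = - a\<close> and \<open>s z b = z b\<close>, so \<open>a z b\<close> is its own
  negative.\<close>

lemma sandwich_scalar:
  assumes z: "z \<in> perms n"
  shows "\<exists>c::'k::field_char_0. \<forall>\<sigma>.
    (\<Sum>\<pi>\<in>perms n. column_antisymmetrizer \<pi> * row_symmetrizer (inv z \<circ> (inv \<pi> \<circ> \<sigma>))) =
    c * young_symmetrizer \<sigma>"
proof (cases "\<forall>x\<in>{1..n}. \<forall>y\<in>{1..n}. col x = col y \<longrightarrow> row (inv z x) = row (inv z y) \<longrightarrow> x = y")
  case True
  then obtain q where q: "q \<in> C" "q \<circ> z \<in> R"
    using factor_through_stabilizers[OF z] by blast
  have "(\<Sum>\<pi>\<in>perms n. column_antisymmetrizer \<pi> * row_symmetrizer (inv z \<circ> (inv \<pi> \<circ> \<sigma>))) =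
    (of_int (sign q) :: 'k) * young_symmetrizer \<sigma>" for \<sigma>
  proof -
    have "row_symmetrizer (inv z \<circ> (inv (\<pi> \<circ> q) \<circ> \<sigma>)) = (row_symmetrizer (inv \<pi> \<circ> \<sigma>) :: 'k)"
      if "\<pi> \<in> perms n" for \<pi>
    proof -
      have "inv z \<circ> (inv (\<pi> \<circ> q) \<circ> \<sigma>) = inv (q \<circ> z) \<circ> (inv \<pi> \<circ> \<sigma>)"
        using that q z by (simp add: inv_comp_perms[OF _ C_perms] inv_comp_perms[OF C_perms] comp_assoc)
      then show ?thesis
        using row_symmetrizer_comp[OF R_inv[OF q(2)]] by simp
    qed
    then show ?thesis
      unfolding young_symmetrizer_def lin_act_def
      by (subst sum_perms_right[OF C_perms[OF q(1)]])
         (simp add: column_antisymmetrizer_comp[OF q(1)] sum_distrib_left mult.assoc)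
  qed
  then show ?thesis
    by blast
next
  case False
  then obtain x y where xy: "x \<in> {1..n}" "y \<in> {1..n}" "col x = col y"
      "row (inv z x) = row (inv z y)" "x \<noteq> y"
    by blast
  define s where "s = transpose x y"
  have sp: "s \<in> perms n"
    using xy by (simp add: s_def perms_def permutes_swap_id)
  have sC: "s \<in> C"
    using sp xy by (auto simp: C_def s_def transpose_def)
  have inv_s: "inv s = s" and sign_s: "sign s = - 1"
    using xy by (simp_all add: s_def sign_swap_id)
  \<comment> \<open>Conjugated by \<open>z\<close>, the transposition exchanges
    \<open>inv z x\<close> and \<open>inv z y\<close>, which lie in the same row.\<close>
  have "row ((inv z \<circ> (s \<circ> z)) w) = row w" for w
    using xy z by (cases "z w = x"; cases "z w = y") (auto simp: s_def)
  then have sR: "inv z \<circ> (s \<circ> z) \<in> R"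
    using sp z by (simp add: R_def)
  have "(\<Sum>\<pi>\<in>perms n. column_antisymmetrizer \<pi> * row_symmetrizer (inv z \<circ> (inv \<pi> \<circ> \<sigma>))) =
    (0 :: 'k)" (is "?M = 0") for \<sigma>
  proof -
    have "row_symmetrizer (inv z \<circ> (inv (\<pi> \<circ> s) \<circ> \<sigma>)) =
        (row_symmetrizer (inv z \<circ> (inv \<pi> \<circ> \<sigma>)) :: 'k)" if "\<pi> \<in> perms n" for \<pi>
    proof -
      have "inv z \<circ> (inv (\<pi> \<circ> s) \<circ> \<sigma>) = (inv z \<circ> (s \<circ> z)) \<circ> (inv z \<circ> (inv \<pi> \<circ> \<sigma>))"
        using that sp z by (simp add: inv_comp_perms inv_s comp_assoc perms_inv_cancel[OF z])
      then show ?thesis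
        using row_symmetrizer_comp[OF sR] by simp
    qed
    then have "?M = - ?M"
      by (subst sum_perms_right[OF sp])
         (simp add: column_antisymmetrizer_comp[OF sC] sign_s sum_negf)
    then show ?thesis
      by simp
  qed
  then show ?thesis
    by (intro exI[of _ 0]) simp
qed

text \<open>A central \<open>z\<close> can be moved between the two factors of the symmetrizer. The
  product \<open>a z b\<close> is linear in \<open>z\<close>, and \<open>sandwich_scalar\<close>
  treats each permutation separately; the scalar is the corresponding combination of the
  \<open>c \<tau>\<close>.\<close>

lemma central_times_young_symmetrizer:
  fixes z :: "(nat \<Rightarrow> nat) \<Rightarrow> 'k::field_char_0"
  assumes "class_fun n z"
  shows "\<exists>c. conv n z young_symmetrizer = (\<lambda>\<sigma>. c * young_symmetrizer \<sigma>)"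
proof -
  have "\<forall>\<tau>\<in>perms n. \<exists>c::'k. \<forall>\<sigma>.
      (\<Sum>\<pi>\<in>perms n. column_antisymmetrizer \<pi> * row_symmetrizer (inv \<tau> \<circ> (inv \<pi> \<circ> \<sigma>))) =
      c * young_symmetrizer \<sigma>"
    by (intro ballI sandwich_scalar)
  from bchoice[OF this] obtain c where c: "\<And>\<tau> \<sigma>. \<tau> \<in> perms n \<Longrightarrow>
      (\<Sum>\<pi>\<in>perms n. column_antisymmetrizer \<pi> * row_symmetrizer (inv \<tau> \<circ> (inv \<pi> \<circ> \<sigma>))) =
      c \<tau> * (young_symmetrizer \<sigma> :: 'k)"
    by blast
  have "conv n z young_symmetrizer = conv n (conv n z column_antisymmetrizer) (row_symmetrizer :: _ \<Rightarrow> 'k)"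
    by (simp add: young_symmetrizer_def conv_assoc)
  also have "\<dots> = conv n (conv n column_antisymmetrizer z) row_symmetrizer"
    by (rule lin_act_cong) (rule conv_class_fun_commute[OF assms])
  also have "\<dots> = conv n column_antisymmetrizer (conv n z row_symmetrizer)"
    by (rule conv_assoc)
  also have "\<dots> = (\<lambda>\<sigma>. (\<Sum>\<tau>\<in>perms n. z \<tau> * c \<tau>) * young_symmetrizer \<sigma>)"
  proof
    fix \<sigma>
    have "conv n column_antisymmetrizer (conv n z row_symmetrizer) \<sigma> = (\<Sum>\<tau>\<in>perms n. z \<tau> *
        (\<Sum>\<pi>\<in>perms n. column_antisymmetrizer \<pi> * row_symmetrizer (inv \<tau> \<circ> (inv \<pi> \<circ> \<sigma>))))"
      unfolding lin_act_def sum_distrib_left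
      by (subst sum.swap) (simp add: mult.left_commute)
    also have "\<dots> = (\<Sum>\<tau>\<in>perms n. z \<tau> * c \<tau>) * young_symmetrizer \<sigma>"
      by (simp add: c sum_distrib_right mult.assoc)
    finally show "conv n column_antisymmetrizer (conv n z row_symmetrizer) \<sigma> =
        (\<Sum>\<tau>\<in>perms n. z \<tau> * c \<tau>) * young_symmetrizer \<sigma>" .
  qed
  finally show ?thesis
    by blast
qed

text \<open>By \<open>C_Int_R\<close> only \<open>\<pi> = id\<close> contributes to this
  coefficient. It is the reason why the sum of conjugates is nonzero.\<close>

lemma young_symmetrizer_id: "young_symmetrizer id = (1::'k::field)"
proof -
  have "column_antisymmetrizer \<pi> * row_symmetrizer (inv \<pi> \<circ> id) = (if \<pi> = id then 1 else 0 :: 'k)"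
    if "\<pi> \<in> perms n" for \<pi>
    using C_Int_R[of \<pi>] R_inv[of "inv \<pi>"] that
    by (auto simp: column_antisymmetrizer_def row_symmetrizer_def C_def R_def)
  then have "young_symmetrizer id = (\<Sum>\<pi>\<in>perms n. if \<pi> = id then 1 else 0 :: 'k)"
    unfolding young_symmetrizer_def lin_act_def by (rule sum.cong[OF refl])
  then show ?thesis
    by simp
qed

lemma young_symmetrizer_outside:
  assumes "\<sigma> \<notin> perms n"
  shows "young_symmetrizer \<sigma> = 0"
proof -
  have "inv \<pi> \<circ> \<sigma> \<notin> perms n" if "\<pi> \<in> perms n" for \<pi>
    using perms_comp[OF that, of "inv \<pi> \<circ> \<sigma>"] assms that by (auto simp: perms_inv_cancel[OF that])
  then show ?thesis
    by (auto simp: young_symmetrizer_def lin_act_def row_symmetrizer_def R_def intro!: sum.neutral)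
qed

text \<open>The factors have values 0, 1 and -1, so the symmetrizer over any field of characteristic
  zero is the image of the rational one. This carries results about \<open>e\<close> to the larger
  field.\<close>

lemma of_rat_young_symmetrizer: "of_rat (young_symmetrizer \<sigma>) = (young_symmetrizer \<sigma> :: 'k::field_char_0)"
proof -
  have "(\<lambda>\<pi>. of_rat (column_antisymmetrizer \<pi>)) = (column_antisymmetrizer :: _ \<Rightarrow> 'k)"
    "(\<lambda>\<pi>. of_rat (row_symmetrizer \<pi>)) = (row_symmetrizer :: _ \<Rightarrow> 'k)"
    by (auto simp: column_antisymmetrizer_def row_symmetrizer_def)
  then show ?thesis
    by (simp add: young_symmetrizer_def of_rat_conv)
qed

lemma polytabloid_eq:
  "polytabloid \<mu> t = lin_act n tabloid_act column_antisymmetrizer (\<lambda>T. if T = tabloid_of \<mu> t then 1 else 0)"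
proof
  fix T
  have "C \<subseteq> perms n"
    by (auto simp: C_def)
  then have "(\<Sum>\<pi>\<in>C. if tabloid_of \<mu> (\<pi> \<circ> t) = T then of_int (sign \<pi>) else 0) =
      (\<Sum>\<pi>\<in>perms n. column_antisymmetrizer \<pi> * (if tabloid_act (inv \<pi>) T = tabloid_of \<mu> t then 1 else 0))"
    by (intro sum.mono_neutral_cong_left)
       (auto simp: column_antisymmetrizer_def tabloid_of_comp tabloid_act_inv_iff)
  then show "polytabloid \<mu> t T =
      lin_act n tabloid_act column_antisymmetrizer (\<lambda>T. if T = tabloid_of \<mu> t then 1 else 0) T"
    by (simp add: polytabloid_def column_stabilizer_eq lin_act_def)
qed

text \<open>A column permutation that fixes the tabloid is also a row permutation, hence the
  identity. Evaluating at this tabloid is how scalars are read off.\<close>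

lemma polytabloid_nonzero: "polytabloid \<mu> t (tabloid_of \<mu> t) = 1"
proof -
  have "polytabloid \<mu> t (tabloid_of \<mu> t) = (\<Sum>\<pi>\<in>C. if \<pi> = id then 1 else 0)"
    unfolding polytabloid_def column_stabilizer_eq
  proof (rule sum.cong[OF refl])
    fix \<pi> assume p: "\<pi> \<in> C"
    have "tabloid_of \<mu> (\<pi> \<circ> t) = tabloid_of \<mu> t \<longleftrightarrow> \<pi> \<in> R"
      by (simp add: tabloid_of_comp tabloid_act_fix C_perms[OF p])
    also have "\<dots> \<longleftrightarrow> \<pi> = id"
      using C_Int_R[OF p] by (auto simp: R_def)
    finally show "(if tabloid_of \<mu> (\<pi> \<circ> t) = tabloid_of \<mu> t then of_int (sign \<pi>) else 0) =
        (if \<pi> = id then 1 else 0)"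
      by simp
  qed
  also have "\<dots> = 1"
    using finite_subset[of C "perms n"] by (auto simp: C_def)
  finally show ?thesis .
qed

text \<open>Every element of \<open>R\<close> fixes the tabloid of \<open>t\<close>, so the row
  symmetrizer contributes the factor \<open>card R\<close> before the columns are
  antisymmetrized.\<close>

lemma young_symmetrizer_polytabloid:
  "lin_act n tabloid_act young_symmetrizer (\<lambda>T. if T = tabloid_of \<mu> t then 1 else 0) =
    (\<lambda>T. of_nat (card R) * polytabloid \<mu> t T :: 'k::field_char_0)"
proof -
  define d :: "tabloid \<Rightarrow> 'k" where "d = (\<lambda>T. if T = tabloid_of \<mu> t then 1 else 0)"
  have "d (tabloid_act (inv \<pi>) T) = d T" if "\<pi> \<in> R" for \<pi> T
    using that R_perms[OF that] tabloid_act_fix[of \<pi>] by (simp add: d_def tabloid_act_inv_iff)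
  then have "lin_act n tabloid_act row_symmetrizer d = (\<lambda>T. \<Sum>\<pi>\<in>R. d T)"
    unfolding lin_act_def
    by (intro ext sum.mono_neutral_cong_right) (auto simp: row_symmetrizer_def R_def)
  then have "lin_act n tabloid_act young_symmetrizer d = lin_act n tabloid_act column_antisymmetrizer (\<lambda>T. of_nat (card R) * d T)"
    by (simp add: young_symmetrizer_def lin_act_conv tabloid_act_comp)
  then show ?thesis
    by (simp add: lin_act_scale polytabloid_eq d_def)
qed

text \<open>Let \<open>z\<close> act on the symmetrizer by \<open>c\<close>. Applying both to the
  tabloid of \<open>t\<close> and comparing coefficients at that tabloid gives
  \<open>c * card R = card R\<close>, and \<open>R\<close> contains the identity.\<close>

lemma central_fixes_young_symmetrizer:
  fixes z :: "(nat \<Rightarrow> nat) \<Rightarrow> 'k::field_char_0"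
  assumes z: "class_fun n z" and fixed: "group_algebra_act n z (polytabloid \<mu> t) = polytabloid \<mu> t"
  shows "conv n z young_symmetrizer = young_symmetrizer"
proof -
  define d :: "tabloid \<Rightarrow> 'k" where "d = (\<lambda>T. if T = tabloid_of \<mu> t then 1 else 0)"
  obtain c where c: "conv n z young_symmetrizer = (\<lambda>\<sigma>. c * young_symmetrizer \<sigma>)"
    using central_times_young_symmetrizer[OF z] by blast
  have y: "lin_act n tabloid_act young_symmetrizer d = (\<lambda>T. of_nat (card R) * polytabloid \<mu> t T)"
    unfolding d_def by (rule young_symmetrizer_polytabloid)
  have "lin_act n tabloid_act (conv n z young_symmetrizer) d =
      lin_act n tabloid_act z (lin_act n tabloid_act young_symmetrizer d)"
    by (rule lin_act_conv) (simp add: tabloid_act_comp)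
  then have "(\<lambda>T. c * (of_nat (card R) * polytabloid \<mu> t T)) = (\<lambda>T. of_nat (card R) * polytabloid \<mu> t T :: 'k)"
    using fixed by (simp add: c lin_act_scale_left y lin_act_scale group_algebra_act_eq_lin_act)
  then have "c * of_nat (card R) = of_nat (card R)"
    using polytabloid_nonzero[where 'a='k] by (metis mult.right_neutral)
  moreover have "card R \<noteq> 0"
  proof -
    have "finite R" "id \<in> R"
      by (auto simp: R_def)
    then show ?thesis
      by auto
  qed
  ultimately show ?thesis
    by (simp add: c)
qed

section \<open>The sum of the conjugates of the Young symmetrizer\<close>

definition conjugate_sum :: "(nat \<Rightarrow> nat) \<Rightarrow> 'k::field" where
  "conjugate_sum \<sigma> = (\<Sum>\<tau>\<in>perms n. young_symmetrizer (inv \<tau> \<circ> \<sigma> \<circ> \<tau>))"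

lemma class_fun_conjugate_sum: "class_fun n conjugate_sum"
  unfolding class_fun_def
proof (intro ballI)
  fix \<sigma> \<tau> assume p: "\<sigma> \<in> perms n" "\<tau> \<in> perms n"
  show "conjugate_sum (\<sigma> \<circ> \<tau>) = conjugate_sum (\<tau> \<circ> \<sigma>)"
    unfolding conjugate_sum_def
    by (subst sum_perms_left[OF p(1)])
       (simp add: p inv_comp_perms[OF p(1)] comp_assoc perms_inv_cancel[OF p(1)])
qed

lemma conjugate_sum_id: "conjugate_sum id = of_nat (card (perms n))"
  by (simp add: conjugate_sum_def perms_inv_left young_symmetrizer_id)

lemma conjugate_sum_outside:
  assumes "\<sigma> \<notin> perms n"
  shows "conjugate_sum \<sigma> = 0"
proof -
  have "inv \<tau> \<circ> \<sigma> \<circ> \<tau> \<notin> perms n" if "\<tau> \<in> perms n" for \<tau>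
  proof
    assume "inv \<tau> \<circ> \<sigma> \<circ> \<tau> \<in> perms n"
    then have "\<tau> \<circ> (inv \<tau> \<circ> \<sigma> \<circ> \<tau>) \<circ> inv \<tau> \<in> perms n"
      using that perms_comp perms_inv by blast
    with assms show False
      by (simp add: comp_assoc perms_inv_cancel[OF that] perms_inv_right[OF that])
  qed
  then show ?thesis
    by (simp add: conjugate_sum_def young_symmetrizer_outside)
qed

lemma of_rat_conjugate_sum: "of_rat (conjugate_sum \<sigma>) = (conjugate_sum \<sigma> :: 'k::field_char_0)"
  by (simp add: conjugate_sum_def of_rat_sum of_rat_young_symmetrizer)

text \<open>A class function does not change when its argument is conjugated. Substituting
  \<open>\<tau> \<circ> \<sigma> \<circ> inv \<tau>\<close> for \<open>\<sigma>\<close> therefore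
  reduces the product with each conjugate of the symmetrizer to the product with the symmetrizer
  itself, and the scalar is the same for all of them.\<close>

lemma conv_conjugate_sum:
  assumes z: "class_fun n z"
    and c: "conv n z young_symmetrizer = (\<lambda>\<sigma>. c * young_symmetrizer \<sigma>)"
  shows "conv n z conjugate_sum = (\<lambda>\<sigma>. c * conjugate_sum \<sigma>)"
proof
  fix \<rho>
  have "conv n z conjugate_sum \<rho> =
      (\<Sum>\<tau>\<in>perms n. \<Sum>\<sigma>\<in>perms n. z \<sigma> * young_symmetrizer (inv \<tau> \<circ> (inv \<sigma> \<circ> \<rho>) \<circ> \<tau>))"
    unfolding lin_act_def conjugate_sum_def sum_distrib_left by (rule sum.swap)
  also have "\<dots> = (\<Sum>\<tau>\<in>perms n. conv n z young_symmetrizer (inv \<tau> \<circ> \<rho> \<circ> \<tau>))"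
  proof (rule sum.cong[OF refl])
    fix \<tau> assume t: "\<tau> \<in> perms n"
    have "z (\<tau> \<circ> (\<sigma> \<circ> inv \<tau>)) * young_symmetrizer (inv \<tau> \<circ> (inv (\<tau> \<circ> (\<sigma> \<circ> inv \<tau>)) \<circ> \<rho>) \<circ> \<tau>) =
        z \<sigma> * young_symmetrizer (inv \<sigma> \<circ> (inv \<tau> \<circ> \<rho> \<circ> \<tau>))" if s: "\<sigma> \<in> perms n" for \<sigma>
    proof -
      have "z (\<tau> \<circ> (\<sigma> \<circ> inv \<tau>)) = z ((\<sigma> \<circ> inv \<tau>) \<circ> \<tau>)"
        using z t s perms_comp[OF s perms_inv[OF t]] unfolding class_fun_def by blast
      then show ?thesis
        using s t by (simp add: inv_comp_perms[OF t perms_comp] inv_comp_perms comp_assoc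
            perms_inv_cancel[OF t] perms_inv_left[OF t])
    qed
    then show "(\<Sum>\<sigma>\<in>perms n. z \<sigma> * young_symmetrizer (inv \<tau> \<circ> (inv \<sigma> \<circ> \<rho>) \<circ> \<tau>)) =
        conv n z young_symmetrizer (inv \<tau> \<circ> \<rho> \<circ> \<tau>)"
      unfolding lin_act_def
      by (subst sum_perms_left[OF t], subst sum_perms_right[OF perms_inv[OF t]]) simp
  qed
  also have "\<dots> = c * conjugate_sum \<rho>"
    by (simp add: c conjugate_sum_def sum_distrib_left)
  finally show "conv n z conjugate_sum \<rho> = c * conjugate_sum \<rho>" .
qed

text \<open>With the involution that inverts permutations, the rational group algebra has a positive
  definite trace form.  First \<open>p\<^sup>* p\<close> is a nonzero multiple of \<open>p\<close>, so \<open>p\<close> is fixed by the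
  involution; then \<open>p p = p\<^sup>* p\<close> is nonzero.\<close>

lemma conjugate_sum_square:
  obtains c :: rat where "c \<noteq> 0" "conv n conjugate_sum conjugate_sum = (\<lambda>\<sigma>. c * conjugate_sum \<sigma>)"
proof -
  define p :: "(nat \<Rightarrow> nat) \<Rightarrow> rat" where "p = conjugate_sum"
  define p' where "p' \<sigma> = p (inv \<sigma>)" for \<sigma>
  have p_id: "p id > 0"
    using perms_pos[of n] by (auto simp: p_def conjugate_sum_id)
  have pos: "(\<Sum>\<sigma>\<in>perms n. p (inv \<sigma>) * p (inv \<sigma>)) > 0"
  proof -
    have "p id * p id \<le> (\<Sum>\<sigma>\<in>perms n. p (inv \<sigma>) * p (inv \<sigma>))"
      using member_le_sum[of id "perms n" "\<lambda>\<sigma>. p (inv \<sigma>) * p (inv \<sigma>)"] by simp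
    then show ?thesis
      using p_id by (smt (verit) mult_pos_pos order_less_le_trans)
  qed
  have cp: "class_fun n p"
    by (simp add: p_def class_fun_conjugate_sum)
  have cp': "class_fun n p'"
    using cp by (simp add: class_fun_def p'_def inv_comp_perms)
  have scalar: "\<exists>c. conv n z p = (\<lambda>\<sigma>. c * p \<sigma>)" if "class_fun n z" for z
    using central_times_young_symmetrizer[OF that] conv_conjugate_sum[OF that] unfolding p_def by blast
  obtain c' where c': "conv n p' p = (\<lambda>\<sigma>. c' * p \<sigma>)"
    using scalar[OF cp'] by blast
  \<comment> \<open>At \<open>id\<close> the product of \<open>p'\<close> and \<open>p\<close> is a
    sum of rational squares, one of which is the square of \<open>p id\<close>.\<close>
  have "c' * p id > 0"
    using pos fun_cong[OF c', of id] by (simp add: lin_act_def p'_def)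
  then have "c' \<noteq> 0"
    by auto
  have sym: "p (inv \<sigma>) = p \<sigma>" if s: "\<sigma> \<in> perms n" for \<sigma>
  proof -
    have "c' * p (inv \<sigma>) = (\<Sum>\<tau>\<in>perms n. p (inv \<tau>) * p (inv \<tau> \<circ> inv \<sigma>))"
      using fun_cong[OF c', of "inv \<sigma>"] by (simp add: lin_act_def p'_def)
    \<comment> \<open>This substitution exchanges the two factors of each term, up to turning
      \<open>inv \<sigma>\<close> into \<open>\<sigma>\<close>; hence \<open>c' * p\<close> takes
      equal values at \<open>\<sigma>\<close> and \<open>inv \<sigma>\<close>.\<close>
    also have "\<dots> = (\<Sum>\<tau>\<in>perms n. p (inv (inv \<sigma> \<circ> \<tau>)) * p (inv (inv \<sigma> \<circ> \<tau>) \<circ> inv \<sigma>))"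
      by (rule sum_perms_left) (simp add: s)
    also have "\<dots> = (\<Sum>\<tau>\<in>perms n. p (inv \<tau>) * p (inv \<tau> \<circ> \<sigma>))"
      using s by (intro sum.cong) (simp_all add: inv_comp_perms[OF perms_inv] comp_assoc perms_inv_right[OF s])
    also have "\<dots> = c' * p \<sigma>"
      using fun_cong[OF c', of \<sigma>] by (simp add: lin_act_def p'_def)
    finally show ?thesis
      using \<open>c' \<noteq> 0\<close> by simp
  qed
  have "conv n p p = conv n p' p"
    by (rule lin_act_cong) (simp add: p'_def sym)
  with that c' \<open>c' \<noteq> 0\<close> show ?thesis
    by (simp add: p_def)
qed

end

section \<open>Central idempotents of the group algebra\<close>

lemma conv_outside:
  assumes "y \<in> carrier (symmetric_group_algebra n)" "\<rho> \<notin> perms n"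
  shows "conv n x y \<rho> = 0"
proof -
  have "inv \<sigma> \<circ> \<rho> \<notin> perms n" if "\<sigma> \<in> perms n" for \<sigma>
    using perms_comp[OF that, of "inv \<sigma> \<circ> \<rho>"] assms that by (auto simp: perms_inv_cancel[OF that])
  then show ?thesis
    using assms by (simp add: lin_act_def symmetric_group_algebra_def twisted_algebra_def perms_def)
qed

lemma carrier_symmetric_group_algebra:
  "x \<in> carrier (symmetric_group_algebra n) \<longleftrightarrow> (\<forall>\<sigma>. \<sigma> \<notin> perms n \<longrightarrow> x \<sigma> = 0)"
  by (simp add: symmetric_group_algebra_def twisted_algebra_def perms_def)

text \<open>Centrality is tested on the basis elements: commuting with \<open>inv \<tau>\<close> and
  reading the coefficient at \<open>\<sigma>\<close> compares
  \<open>e (\<sigma> \<circ> \<tau>)\<close> with \<open>e (\<tau> \<circ> \<sigma>)\<close>.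
  Conversely \<open>conv_class_fun_commute\<close> covers permutations and
  \<open>conv_outside\<close> covers all other arguments.\<close>

lemma central_idempotent_symmetric_group_algebra:
  "central_idempotent (symmetric_group_algebra n) e \<longleftrightarrow>
    e \<in> carrier (symmetric_group_algebra n) \<and> conv n e e = e \<and> class_fun n e"
proof -
  let ?A = "symmetric_group_algebra n :: ((nat \<Rightarrow> nat) \<Rightarrow> 'a) ring"
  have "(\<forall>x\<in>carrier ?A. conv n e x = conv n x e) \<longleftrightarrow> class_fun n e" if e: "e \<in> carrier ?A"
  proof
    assume comm: "\<forall>x\<in>carrier ?A. conv n e x = conv n x e"
    show "class_fun n e"
      unfolding class_fun_def
    proof (intro ballI)
      fix \<sigma> \<tau> assume p: "\<sigma> \<in> perms n" "\<tau> \<in> perms n"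
      define d :: "(nat \<Rightarrow> nat) \<Rightarrow> 'a" where "d = single (inv \<tau>)"
      have "d \<in> carrier ?A"
        using p by (auto simp: carrier_symmetric_group_algebra d_def single_def)
      with comm have "conv n e d \<sigma> = conv n d e \<sigma>"
        by simp
      moreover have "conv n d e \<sigma> = e (\<tau> \<circ> \<sigma>)"
        using p by (simp add: lin_act_def d_def single_def if_distrib[of "\<lambda>x. x * _"] cong: if_cong)
      moreover have "conv n e d \<sigma> = e (\<sigma> \<circ> \<tau>)"
      proof -
        have "(inv \<rho> \<circ> \<sigma> = inv \<tau>) = (\<rho> = \<sigma> \<circ> \<tau>)" if r: "\<rho> \<in> perms n" for \<rho>
        proof
          assume "inv \<rho> \<circ> \<sigma> = inv \<tau>"
          then have "\<rho> \<circ> (inv \<rho> \<circ> \<sigma>) \<circ> \<tau> = \<rho> \<circ> inv \<tau> \<circ> \<tau>"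
            by (simp add: comp_assoc)
          then show "\<rho> = \<sigma> \<circ> \<tau>"
            by (simp add: comp_assoc perms_inv_cancel[OF r] perms_inv_left[OF p(2)])
        qed (simp add: inv_comp_perms[OF p] comp_assoc perms_inv_left[OF p(1)])
        then have "conv n e d \<sigma> = (\<Sum>\<rho>\<in>perms n. if \<rho> = \<sigma> \<circ> \<tau> then e \<rho> else 0)"
          unfolding lin_act_def by (intro sum.cong) (auto simp: d_def single_def)
        then show ?thesis
          using p by simp
      qed
      ultimately show "e (\<sigma> \<circ> \<tau>) = e (\<tau> \<circ> \<sigma>)"
        by simp
    qed
  next
    assume c: "class_fun n e"
    show "\<forall>x\<in>carrier ?A. conv n e x = conv n x e"
    proof (intro ballI ext)
      fix x \<rho> assume "x \<in> carrier ?A"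
      then show "conv n e x \<rho> = conv n x e \<rho>"
        using conv_class_fun_commute[OF c] conv_outside e by (cases "\<rho> \<in> perms n") fastforce+
    qed
  qed
  note * = this
  show ?thesis
  proof (cases "e \<in> carrier ?A")
    case True
    have "(\<forall>x\<in>carrier ?A. e \<otimes>\<^bsub>?A\<^esub> x = x \<otimes>\<^bsub>?A\<^esub> e) \<longleftrightarrow>
        (\<forall>x\<in>carrier ?A. conv n e x = conv n x e)"
      by (rule ball_cong[OF refl]) (simp only: symmetric_group_algebra_mult True)
    then show ?thesis
      unfolding central_idempotent_def symmetric_group_algebra_mult[OF True] *[OF True] by blast
  qed (simp add: central_idempotent_def)
qed

context young_tableau
begin

lemma polytabloid_in_specht: "(polytabloid \<mu> t :: tabloid \<Rightarrow> 'k::field) \<in> specht \<mu>"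
proof -
  interpret module "\<lambda>(c::'k) v (T::tabloid). c * v T"
    by unfold_locales (auto simp: fun_eq_iff algebra_simps)
  show ?thesis
    unfolding specht_def using tableau by (intro span_base imageI)
qed

text \<open>The multiple \<open>f\<close> of the conjugate sum is a nonzero central idempotent with
  \<open>e f = f\<close>, because \<open>e\<close> fixes a polytabloid and hence the symmetrizer.
  Then \<open>e = f + (e - f)\<close> is an orthogonal decomposition, and primitivity of
  \<open>e\<close> leaves only \<open>e = f\<close>.\<close>

lemma specht_idempotent_eq:
  assumes "specht_idempotent n \<mu> e"
  obtains c where "e = (\<lambda>\<sigma>. c * conjugate_sum \<sigma>)"
proof -
  let ?A = "symmetric_group_algebra n :: ((nat \<Rightarrow> nat) \<Rightarrow> rat) ring"
  have prim: "primitive_central_idempotent ?A e"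
    and fixes_specht: "\<And>v. v \<in> specht \<mu> \<Longrightarrow> group_algebra_act n e v = v"
    using assms by (auto simp: specht_idempotent_def)
  have e: "e \<in> carrier ?A" "conv n e e = e" "class_fun n e"
    using prim by (auto simp: primitive_central_idempotent_def central_idempotent_symmetric_group_algebra)
  obtain c where c: "c \<noteq> 0" "conv n conjugate_sum conjugate_sum = (\<lambda>\<sigma>. c * conjugate_sum \<sigma> :: rat)"
    by (rule conjugate_sum_square)
  \<comment> \<open>Since \<open>p p\<close> is \<open>c\<close> times \<open>p\<close>, division by
    \<open>c\<close> makes \<open>p\<close> idempotent.\<close>
  define f :: "(nat \<Rightarrow> nat) \<Rightarrow> rat" where "f = (\<lambda>\<sigma>. inverse c * conjugate_sum \<sigma>)"
  have f: "f \<in> carrier ?A" "class_fun n f"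
    using class_fun_conjugate_sum
    by (auto simp: carrier_symmetric_group_algebra f_def conjugate_sum_outside class_fun_def)
  have ff: "conv n f f = f"
    unfolding f_def lin_act_scale lin_act_scale_left c(2) using c(1) by (simp add: fun_eq_iff)
  have f0: "f \<noteq> (\<lambda>_. 0)"
  proof
    assume "f = (\<lambda>_. 0)"
    then have "f id = 0"
      by simp
    then show False
      using c(1) perms_pos[of n] by (simp add: f_def conjugate_sum_id)
  qed
  have "conv n e young_symmetrizer = young_symmetrizer"
    by (intro central_fixes_young_symmetrizer e fixes_specht polytabloid_in_specht)
  then have "conv n e conjugate_sum = conjugate_sum"
    using conv_conjugate_sum[OF e(3), of 1] by simp
  then have ef: "conv n e f = f"
    by (simp add: f_def lin_act_scale)
  have fe: "conv n f e = f"
    using e f ef conv_outside[OF e(1)] conv_class_fun_commute[OF f(2)]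
    by (metis (no_types) ext carrier_symmetric_group_algebra)
  \<comment> \<open>The difference is written as a sum with the scalar \<open>- 1\<close>, so that
    \<open>lin_act_add\<close> and \<open>lin_act_scale\<close> apply to it.\<close>
  define g where "g = (\<lambda>\<sigma>. e \<sigma> + - 1 * f \<sigma>)"
  have conv_g: "conv n x g = (\<lambda>\<sigma>. conv n x e \<sigma> + - 1 * conv n x f \<sigma>)" for x
    unfolding g_def by (simp only: lin_act_add lin_act_scale)
  have g_conv: "conv n g x = (\<lambda>\<sigma>. conv n e x \<sigma> + - 1 * conv n f x \<sigma>)" for x
    unfolding g_def lin_act_def by (simp add: algebra_simps sum_subtractf)
  have g: "g \<in> carrier ?A" "class_fun n g"
    using e f by (auto simp: g_def carrier_symmetric_group_algebra class_fun_def)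
  have gg: "conv n g g = g"
    unfolding conv_g g_conv by (simp add: e ff ef fe g_def)
  have fg: "conv n f g = (\<lambda>_. 0)"
    unfolding conv_g by (simp add: ff fe)
  have "central_idempotent ?A f" "central_idempotent ?A g"
    using f ff g gg by (simp_all add: central_idempotent_symmetric_group_algebra)
  moreover have "f \<otimes>\<^bsub>?A\<^esub> g = \<zero>\<^bsub>?A\<^esub>"
    by (simp add: symmetric_group_algebra_mult g fg) (simp add: symmetric_group_algebra_def twisted_algebra_def)
  moreover have "e = f \<oplus>\<^bsub>?A\<^esub> g"
    by (simp add: g_def symmetric_group_algebra_def twisted_algebra_def)
  ultimately have "f = \<zero>\<^bsub>?A\<^esub> \<or> g = \<zero>\<^bsub>?A\<^esub>"
    using prim unfolding primitive_central_idempotent_def by blast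
  then have "g = (\<lambda>_. 0)"
    using f0 by (simp add: symmetric_group_algebra_def twisted_algebra_def)
  then have "e = f"
    by (simp add: g_def fun_eq_iff)
  then show ?thesis
    using that f_def by simp
qed

text \<open>This is the passage from the rationals to the larger field: \<open>e\<close> is a
  rational multiple of the conjugate sum, whose image in the larger field is the conjugate sum
  there, and \<open>z\<close> acts on the latter by the scalar 1.\<close>

lemma conv_specht_idempotent:
  fixes z :: "(nat \<Rightarrow> nat) \<Rightarrow> 'k::field_char_0"
  assumes e: "specht_idempotent n \<mu> e" and z: "class_fun n z"
    and fixed: "group_algebra_act n z (polytabloid \<mu> t) = polytabloid \<mu> t"
  shows "conv n z (\<lambda>\<sigma>. of_rat (e \<sigma>)) = (\<lambda>\<sigma>. of_rat (e \<sigma>))"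
proof -
  obtain c where c: "e = (\<lambda>\<sigma>. c * conjugate_sum \<sigma>)"
    using specht_idempotent_eq[OF e] by blast
  have "conv n z young_symmetrizer = (\<lambda>\<sigma>. 1 * young_symmetrizer \<sigma>)"
    using central_fixes_young_symmetrizer[OF z fixed] by simp
  from conv_conjugate_sum[OF z this] show ?thesis
    by (simp add: c of_rat_mult of_rat_conjugate_sum lin_act_scale)
qed

end

lemma tableaux_nonempty:
  obtains t where "t \<in> tableaux \<mu>"
proof -
  have eq: "boxes \<mu> = (SIGMA i:{..<length \<mu>}. {..<\<mu> ! i})"
    by (auto simp: boxes_def)
  have "finite (boxes \<mu>)" "card (boxes \<mu>) = card {1..sum_list \<mu>}"
    unfolding eq by (simp_all add: sum_list_sum_nth atLeast0LessThan)
  then obtain t where "bij_betw t (boxes \<mu>) {1..sum_list \<mu>}"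
    using finite_same_card_bij by blast
  then show ?thesis
    using that by (auto simp: tableaux_def)
qed

section \<open>Relabelling Brauer diagrams\<close>

abbreviation edge_rel :: "'v set set \<Rightarrow> ('v \<times> 'v) set" where
  "edge_rel E \<equiv> {(x, y). {x, y} \<in> E}"

lemma rtrancl_edge_rel_image:
  assumes "bij g"
  shows "(g x, g y) \<in> (edge_rel ((`) g ` E))\<^sup>* \<longleftrightarrow> (x, y) \<in> (edge_rel E)\<^sup>*"
proof
  have edge: "{g x, g y} \<in> (`) g ` E \<longleftrightarrow> {x, y} \<in> E" for x y
  proof -
    have "{g x, g y} = g ` {x, y}"
      by simp
    then show ?thesis
      using inj_image_mem_iff[of "(`) g" "{x, y}" E] assms by (metis bij_is_inj inj_image_eq_iff injI)
  qed
  have "(g x, z) \<in> (edge_rel ((`) g ` E))\<^sup>* \<Longrightarrow> (x, inv g z) \<in> (edge_rel E)\<^sup>*" for z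
  proof (induction rule: rtrancl_induct)
    case base
    then show ?case
      using assms by (simp add: bij_is_inj)
  next
    case (step y z)
    have "(inv g y, inv g z) \<in> edge_rel E"
      using step.hyps(2) edge[of "inv g y" "inv g z"] assms by (simp add: bij_is_surj surj_f_inv_f)
    with step.IH show ?case
      by (rule rtrancl_into_rtrancl)
  qed
  from this[of "g y"] show "(g x, g y) \<in> (edge_rel ((`) g ` E))\<^sup>* \<Longrightarrow> (x, y) \<in> (edge_rel E)\<^sup>*"
    using assms by (simp add: bij_is_inj)
  show "(x, y) \<in> (edge_rel E)\<^sup>* \<Longrightarrow> (g x, g y) \<in> (edge_rel ((`) g ` E))\<^sup>*"
  proof (induction rule: rtrancl_induct)
    case (step y z)
    then have "(g y, g z) \<in> edge_rel ((`) g ` E)"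
      using edge[of y z] by simp
    with step.IH show ?case
      by (rule rtrancl_into_rtrancl)
  qed simp
qed

lemma components_image:
  assumes "bij g"
  shows "components ((`) g ` E) = (`) g ` components E"
proof -
  have "(edge_rel ((`) g ` E))\<^sup>* `` {g x} = g ` ((edge_rel E)\<^sup>* `` {x})" for x
  proof (rule Set.set_eqI)
    fix z
    obtain y where z: "z = g y"
      using assms by (metis bij_pointE)
    show "z \<in> (edge_rel ((`) g ` E))\<^sup>* `` {g x} \<longleftrightarrow> z \<in> g ` ((edge_rel E)\<^sup>* `` {x})"
      unfolding z using rtrancl_edge_rel_image[OF assms, of x y E] assms
      by (simp add: inj_image_mem_iff bij_is_inj)
  qed
  moreover have "\<Union>((`) g ` E) = g ` \<Union>E"
    by auto
  ultimately show ?thesis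
    by (simp add: components_def quotient_def image_UN image_image UNION_singleton_eq_range)
qed

lemma components_eqI:
  assumes cover: "\<Union>P = \<Union>E" and nonempty: "{} \<notin> P"
    and disj: "\<And>K K' x. K \<in> P \<Longrightarrow> K' \<in> P \<Longrightarrow> x \<in> K \<Longrightarrow> x \<in> K' \<Longrightarrow> K = K'"
    and edges: "\<And>e. e \<in> E \<Longrightarrow> \<exists>K\<in>P. e \<subseteq> K"
    and connected: "\<And>K x y. K \<in> P \<Longrightarrow> x \<in> K \<Longrightarrow> y \<in> K \<Longrightarrow> (x, y) \<in> (edge_rel E)\<^sup>*"
  shows "components E = P"
proof -
  have class_eq: "(edge_rel E)\<^sup>* `` {x} = K" if K: "K \<in> P" "x \<in> K" for x K
  proof
    have "y \<in> K" if "(x, y) \<in> (edge_rel E)\<^sup>*" for y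
      using that
    proof (induction rule: rtrancl_induct)
      case base
      show ?case by (rule K)
    next
      case (step y z)
      then obtain K' where "K' \<in> P" "{y, z} \<subseteq> K'"
        using edges by blast
      then have "K = K'"
        using disj[OF K(1), of K' y] step.IH by blast
      with \<open>{y, z} \<subseteq> K'\<close> show ?case
        by blast
    qed
    then show "(edge_rel E)\<^sup>* `` {x} \<subseteq> K"
      by auto
    show "K \<subseteq> (edge_rel E)\<^sup>* `` {x}"
      using connected K by auto
  qed
  show ?thesis
  proof
    show "components E \<subseteq> P"
    proof
      fix X assume "X \<in> components E"
      then obtain x where x: "x \<in> \<Union>P" "X = (edge_rel E)\<^sup>* `` {x}"
        unfolding components_def cover[symmetric] by (rule quotientE)
      then show "X \<in> P"
        using class_eq by blast
    qed
    show "P \<subseteq> components E"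
    proof
      fix K assume K: "K \<in> P"
      then obtain x where x: "x \<in> K"
        using nonempty by (metis ex_in_conv)
      then have "x \<in> \<Union>E"
        using K cover by blast
      then show "K \<in> components E"
        unfolding components_def using class_eq[OF K x] quotientI by metis
    qed
  qed
qed

text \<open>This is the picture of a diagram stacked with the identity: every node \<open>v\<close>
  of the middle row receives a fresh leaf \<open>k v\<close>. A leaf merges nothing, so each
  component is an old pair together with the leaves of its nodes.\<close>

lemma components_pendant_edges:
  assumes part: "partition_on A D" and pairs: "\<And>q. q \<in> D \<Longrightarrow> card q = 2"
    and V: "V \<subseteq> A" and inj: "inj_on k V" and new: "k ` V \<inter> A = {}"
  shows "components (D \<union> (\<lambda>v. {v, k v}) ` V) = (\<lambda>q. q \<union> k ` (q \<inter> V)) ` D"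
proof (rule components_eqI)
  let ?E = "D \<union> (\<lambda>v. {v, k v}) ` V"
  let ?K = "\<lambda>q. q \<union> k ` (q \<inter> V)"
  have union: "\<Union>D = A"
    using part by (simp add: partition_on_def)
  have same: "q = q'" if "q \<in> D" "q' \<in> D" "x \<in> q" "x \<in> q'" for q q' x
    using part that by (auto simp: partition_on_def disjoint_def)
  show "\<Union>(?K ` D) = \<Union>?E"
    using union V by blast
  show "{} \<notin> ?K ` D"
    using part by (auto simp: partition_on_def)
  fix K K' x assume "K \<in> ?K ` D" "K' \<in> ?K ` D"
  then obtain q q' where q: "q \<in> D" "K = ?K q" and q': "q' \<in> D" "K' = ?K q'"
    by blast
  assume x: "x \<in> K" "x \<in> K'"
  show "K = K'"
  proof (cases "x \<in> A")
    case True
    then have "x \<notin> k ` V"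
      using new by blast
    then have "x \<in> q" "x \<in> q'"
      using x q q' by auto
    then show ?thesis
      using same[of q q' x] q q' by simp
  next
    case False
    then have "x \<in> k ` (q \<inter> V)" "x \<in> k ` (q' \<inter> V)"
      using x q q' union by auto
    then obtain v v' where "v \<in> q \<inter> V" "x = k v" "v' \<in> q' \<inter> V" "x = k v'"
      by blast
    then show ?thesis
      using same[of q q' v] q q' inj by (auto simp: inj_on_def)
  qed
next
  let ?E = "D \<union> (\<lambda>v. {v, k v}) ` V"
  let ?K = "\<lambda>q. q \<union> k ` (q \<inter> V)"
  show "\<exists>K\<in>?K ` D. e \<subseteq> K" if e: "e \<in> ?E" for e
  proof -
    consider "e \<in> D" | v where "v \<in> V" "e = {v, k v}"
      using e by blast
    then show ?thesis
    proof cases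
      case 2
      then obtain q where "q \<in> D" "v \<in> q"
        using V part by (auto simp: partition_on_def)
      with 2 show ?thesis
        by (intro bexI[of _ "?K q"]) auto
    qed auto
  qed
  fix K x y assume K: "K \<in> ?K ` D" "x \<in> K" "y \<in> K"
  then obtain q where q: "q \<in> D" "K = ?K q"
    by blast
  have sym: "sym ((edge_rel ?E)\<^sup>*)"
    by (intro sym_rtrancl symI) (simp add: insert_commute)
  have in_q: "(v, w) \<in> (edge_rel ?E)\<^sup>*" if "v \<in> q" "w \<in> q" for v w
  proof (cases "v = w")
    case False
    have "finite q"
      using pairs[OF q(1)] by (metis card.infinite zero_neq_numeral)
    then have "{v, w} = q"
      using that False pairs[OF q(1)] by (intro card_subset_eq) auto
    then show ?thesis
      using q by auto
  qed simp
  have to_q: "\<exists>v\<in>q. (x, v) \<in> (edge_rel ?E)\<^sup>*" if x: "x \<in> K" for x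
  proof (cases "x \<in> q")
    case False
    then obtain v where v: "v \<in> q" "v \<in> V" "x = k v"
      using x q by blast
    then have "{x, v} \<in> ?E"
      by (auto simp: insert_commute)
    then have "(x, v) \<in> (edge_rel ?E)\<^sup>*"
      by (intro r_into_rtrancl) simp
    with v show ?thesis
      by blast
  qed blast
  obtain v w where "v \<in> q" "(x, v) \<in> (edge_rel ?E)\<^sup>*" "w \<in> q" "(y, w) \<in> (edge_rel ?E)\<^sup>*"
    using to_q[OF K(2)] to_q[OF K(3)] by blast
  then show "(x, y) \<in> (edge_rel ?E)\<^sup>*"
    using in_q[of v w] symD[OF sym, of y w] by (meson rtrancl_trans)
qed

section \<open>Relabelling the nodes row by row\<close>

definition relabel :: "(nat \<Rightarrow> nat \<Rightarrow> nat) \<Rightarrow> nat \<times> nat \<Rightarrow> nat \<times> nat" where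
  "relabel h = (\<lambda>(r, i). (r, h r i))"

lemma relabel_simp [simp]: "relabel h (r, i) = (r, h r i)"
  by (simp add: relabel_def)

lemma bij_relabel:
  assumes "\<And>r. bij (h r)"
  shows "bij (relabel h)"
proof (rule bijI)
  show "inj (relabel h)"
    using assms by (auto simp: inj_on_def relabel_def bij_def)
  show "surj (relabel h)"
  proof
    show "UNIV \<subseteq> range (relabel h)"
    proof
      fix x :: "nat \<times> nat"
      have "x = relabel h (fst x, inv (h (fst x)) (snd x))"
        using assms by (simp add: bij_is_surj surj_f_inv_f)
      then show "x \<in> range (relabel h)"
        by blast
    qed
  qed simp
qed

abbreviation relabel_diagram :: "(nat \<Rightarrow> nat \<Rightarrow> nat) \<Rightarrow> diagram \<Rightarrow> diagram" where
  "relabel_diagram h \<equiv> (`) ((`) (relabel h))"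

definition relabel_top :: "(nat \<Rightarrow> nat) \<Rightarrow> diagram \<Rightarrow> diagram" where
  "relabel_top \<sigma> = relabel_diagram (\<lambda>r. if r = 0 then \<sigma> else id)"

text \<open>Relabelling the top by \<open>\<sigma>\<close> is left multiplication by the diagram of
  \<open>\<sigma>\<close>. Relabelling the bottom by \<open>\<sigma>\<close> is right multiplication
  by the diagram of \<open>inv \<sigma>\<close>, since \<open>perm_diagram\<close> joins the bottom
  node \<open>i\<close> to the top node \<open>\<sigma> i\<close>.\<close>

definition relabel_bottom :: "(nat \<Rightarrow> nat) \<Rightarrow> diagram \<Rightarrow> diagram" where
  "relabel_bottom \<sigma> = relabel_diagram (\<lambda>r. if r = 0 then id else \<sigma>)"

lemma relabel_diagram_comp: "relabel_diagram h (relabel_diagram h' d) = relabel_diagram (\<lambda>r. h r \<circ> h' r) d"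
  by (simp add: image_image relabel_def case_prod_unfold)

lemma relabel_top_comp: "relabel_top (\<sigma> \<circ> \<tau>) = relabel_top \<sigma> \<circ> relabel_top \<tau>"
  unfolding relabel_top_def comp_def relabel_diagram_comp
  by (rule ext, rule arg_cong[where f="\<lambda>h. relabel_diagram h _"]) (auto simp: fun_eq_iff)

lemma relabel_top_bottom: "relabel_top \<sigma> (relabel_bottom \<tau> d) = relabel_bottom \<tau> (relabel_top \<sigma> d)"
  unfolding relabel_top_def relabel_bottom_def relabel_diagram_comp
  by (rule arg_cong[where f="\<lambda>h. relabel_diagram h _"]) auto

lemma relabel_id: "relabel (\<lambda>_. id) = id"
  by (simp add: relabel_def fun_eq_iff)

lemma relabel_top_inv [simp]:
  assumes "bij \<sigma>"
  shows "relabel_top (inv \<sigma>) (relabel_top \<sigma> d) = d" "relabel_top \<sigma> (relabel_top (inv \<sigma>) d) = d"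
  using assms unfolding relabel_top_def relabel_diagram_comp
  by (simp_all add: relabel_id bij_is_inj bij_is_surj surj_iff[THEN iffD1] if_distrib cong: if_cong)

lemma relabel_bottom_inv [simp]:
  assumes "bij \<sigma>"
  shows "relabel_bottom (inv \<sigma>) (relabel_bottom \<sigma> d) = d" "relabel_bottom \<sigma> (relabel_bottom (inv \<sigma>) d) = d"
  using assms unfolding relabel_bottom_def relabel_diagram_comp
  by (simp_all add: relabel_id bij_is_inj bij_is_surj surj_iff[THEN iffD1] if_distrib cong: if_cong)

definition inner :: "(nat \<times> nat) set \<Rightarrow> bool" where
  "inner K \<longleftrightarrow> (\<forall>(r, i)\<in>K. r = 1)"

definition trace :: "(nat \<times> nat) set \<Rightarrow> (nat \<times> nat) set" where
  "trace K = (\<lambda>(r, i). (r div 2, i)) ` {(r, i) \<in> K. r \<noteq> 1}"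

lemma loops_eq: "loops a b = card {K \<in> components (stack a b). inner K}"
  by (simp add: loops_def inner_def)

lemma compose_diagrams_eq: "compose_diagrams a b = trace ` {K \<in> components (stack a b). \<not> inner K}"
  unfolding compose_diagrams_def inner_def[symmetric] trace_def[symmetric] by blast

lemma trace_iff: "(s, i) \<in> trace K \<longleftrightarrow> (\<exists>r. r \<noteq> 1 \<and> s = r div 2 \<and> (r, i) \<in> K)"
  by (auto simp: trace_def image_iff)

lemma relabel_image_iff: "(r, j) \<in> relabel h ` K \<longleftrightarrow> (\<exists>i. j = h r i \<and> (r, i) \<in> K)"
  by (force simp: relabel_def)

text \<open>A relabelling \<open>h\<close> of the stacked picture is a graph isomorphism that
  preserves rows, so it maps components to components and inner ones to inner ones. The composite
  forgets row 1, so \<open>h 1\<close> may be any bijection, and row 2 becomes row 1, which explains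
  \<open>h' (r div 2)\<close>.\<close>

lemma stack_relabel:
  assumes stack: "stack a' b' = relabel_diagram h (stack a b)"
    and bij: "\<And>r. bij (h r)" and top: "h' 0 = h 0" and bottom: "\<And>r. r \<ge> 2 \<Longrightarrow> h r = h' (r div 2)"
  shows "loops a' b' = loops a b" "compose_diagrams a' b' = relabel_diagram h' (compose_diagrams a b)"
proof -
  have comps: "components (stack a' b') = (`) (relabel h) ` components (stack a b)"
    unfolding stack by (rule components_image[OF bij_relabel[OF bij]])
  have filter: "{K \<in> (`) (relabel h) ` X. Q K} = (`) (relabel h) ` {K \<in> X. Q (relabel h ` K)}" for X Q
    by blast
  have inner: "inner (relabel h ` K) \<longleftrightarrow> inner K" for K
    by (auto simp: inner_def relabel_def)
  have trace: "trace (relabel h ` K) = relabel h' ` trace K" for K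
  proof -
    have h: "h r i = h' (r div 2) i" if "r \<noteq> 1" for r i
    proof (cases "r = 0")
      case False
      with that have "r \<ge> 2" by simp
      then show ?thesis by (simp add: bottom)
    qed (simp add: top)
    have "(s, j) \<in> trace (relabel h ` K) \<longleftrightarrow> (\<exists>r. r \<noteq> 1 \<and> s = r div 2 \<and> (\<exists>i. j = h r i \<and> (r, i) \<in> K))" for s j
      unfolding trace_iff relabel_image_iff by blast
    moreover have "(s, j) \<in> relabel h' ` trace K \<longleftrightarrow> (\<exists>r. r \<noteq> 1 \<and> s = r div 2 \<and> (\<exists>i. j = h' (r div 2) i \<and> (r, i) \<in> K))" for s j
      unfolding trace_iff relabel_image_iff by blast
    moreover have "(\<exists>r. r \<noteq> 1 \<and> s = r div 2 \<and> (\<exists>i. j = h r i \<and> (r, i) \<in> K)) \<longleftrightarrow>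
        (\<exists>r. r \<noteq> 1 \<and> s = r div 2 \<and> (\<exists>i. j = h' (r div 2) i \<and> (r, i) \<in> K))" for s j
      using h by metis
    ultimately show ?thesis
      unfolding set_eq_iff split_paired_All by blast
  qed
  have "inj ((`) (relabel h))"
    using bij_relabel[of h, OF bij] by (simp add: bij_is_inj inj_on_image inj_image_eq_iff injI)
  then show "loops a' b' = loops a b"
    unfolding loops_eq comps filter inner by (simp add: card_image inj_on_subset)
  show "compose_diagrams a' b' = relabel_diagram h' (compose_diagrams a b)"
    unfolding compose_diagrams_eq comps filter inner image_image trace ..
qed

lemma compose_diagrams_eqI:
  assumes "components (stack a b) = K ` d" "\<And>p. p \<in> d \<Longrightarrow> \<not> inner (K p)" "\<And>p. p \<in> d \<Longrightarrow> trace (K p) = p"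
  shows "loops a b = 0" "compose_diagrams a b = d"
proof -
  have *: "{X \<in> K ` d. inner X} = {}" "{X \<in> K ` d. \<not> inner X} = K ` d"
    using assms(2) by auto
  show "loops a b = 0"
    unfolding loops_eq assms(1) *(1) by (rule card.empty)
  show "compose_diagrams a b = d"
    unfolding compose_diagrams_eq assms(1) *(2) using assms(3) by (simp add: image_image)
qed

lemma diagrams_rows:
  assumes "d \<in> diagrams n m" "p \<in> d" "(r, i) \<in> p"
  shows "r = 0 \<and> i \<in> {1..n} \<or> r = 1 \<and> i \<in> {1..m}"
  using assms unfolding diagrams_def pair_partitions_def partition_on_def by blast

lemma compose_relabel_top:
  assumes "bij \<sigma>"
  shows "loops (relabel_top \<sigma> a) b = loops a b"
    and "compose_diagrams (relabel_top \<sigma> a) b = relabel_top \<sigma> (compose_diagrams a b)"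
proof -
  have "stack (relabel_top \<sigma> a) b = relabel_diagram (\<lambda>r. if r = 0 then \<sigma> else id) (stack a b)"
    unfolding stack_def relabel_top_def image_Un image_image
    by (auto simp: relabel_def case_prod_unfold)
  note * = stack_relabel[OF this, where h' = "\<lambda>r. if r = 0 then \<sigma> else id"]
  show "loops (relabel_top \<sigma> a) b = loops a b"
    by (rule *(1)) (use assms in auto)
  have "compose_diagrams (relabel_top \<sigma> a) b =
      relabel_diagram (\<lambda>r. if r = 0 then \<sigma> else id) (compose_diagrams a b)"
    by (rule *(2)) (use assms in auto)
  then show "compose_diagrams (relabel_top \<sigma> a) b = relabel_top \<sigma> (compose_diagrams a b)"
    unfolding relabel_top_def .
qed

lemma relabel_image_cong:
  assumes "\<And>p x. p \<in> d \<Longrightarrow> x \<in> p \<Longrightarrow> f x = g x"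
  shows "(`) f ` d = (`) g ` d"
  using assms by (intro image_cong refl) auto

lemma compose_relabel_bottom:
  assumes "bij \<sigma>" "a \<in> diagrams n m"
  shows "loops a (relabel_bottom \<sigma> b) = loops a b"
    and "compose_diagrams a (relabel_bottom \<sigma> b) = relabel_bottom \<sigma> (compose_diagrams a b)"
proof -
  \<comment> \<open>In the stacked picture the bottom row of \<open>b\<close> is row 2. Since
    \<open>a\<close> has nodes in rows 0 and 1 only, this relabelling leaves it alone.\<close>
  let ?h = "\<lambda>r::nat. if r = 0 \<or> r = 1 then id else \<sigma>"
  have "relabel_diagram ?h a = (`) id ` a"
    by (rule relabel_image_cong) (use diagrams_rows[OF assms(2)] in fastforce)
  then have a: "relabel_diagram ?h a = a"
    by simp
  have "stack a (relabel_bottom \<sigma> b) = relabel_diagram ?h (stack a b)"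
    unfolding stack_def image_Un a
    by (simp add: relabel_bottom_def image_image relabel_def case_prod_unfold)
  note * = stack_relabel[OF this, where h' = "\<lambda>r. if r = 0 then id else \<sigma>"]
  show "loops a (relabel_bottom \<sigma> b) = loops a b"
    by (rule *(1)) (use assms in auto)
  have "compose_diagrams a (relabel_bottom \<sigma> b) =
      relabel_diagram (\<lambda>r. if r = 0 then id else \<sigma>) (compose_diagrams a b)"
    by (rule *(2)) (use assms in auto)
  then show "compose_diagrams a (relabel_bottom \<sigma> b) = relabel_bottom \<sigma> (compose_diagrams a b)"
    unfolding relabel_bottom_def .
qed

lemma compose_relabel_middle:
  assumes "bij \<sigma>" "a \<in> diagrams n m"
  shows "loops (relabel_bottom \<sigma> a) (relabel_top \<sigma> b) = loops a b"
    and "compose_diagrams (relabel_bottom \<sigma> a) (relabel_top \<sigma> b) = compose_diagrams a b"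
proof -
  \<comment> \<open>\<open>relabel_bottom\<close> moves every row except row 0; on a diagram this
    amounts to row 1, the middle row of the picture.\<close>
  have "relabel_bottom \<sigma> a = relabel_diagram (\<lambda>r. if r = 1 then \<sigma> else id) a"
    unfolding relabel_bottom_def using diagrams_rows[OF assms(2)]
    by (intro relabel_image_cong) fastforce
  then have "stack (relabel_bottom \<sigma> a) (relabel_top \<sigma> b) = relabel_diagram (\<lambda>r. if r = 1 then \<sigma> else id) (stack a b)"
    unfolding stack_def relabel_top_def image_Un image_image
    by (auto simp: relabel_def case_prod_unfold)
  note * = stack_relabel[OF this, where h' = "\<lambda>_. id"]
  show "loops (relabel_bottom \<sigma> a) (relabel_top \<sigma> b) = loops a b"
    by (rule *(1)) (use assms in auto)
  have "compose_diagrams (relabel_bottom \<sigma> a) (relabel_top \<sigma> b) = relabel_diagram (\<lambda>_. id) (compose_diagrams a b)"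
    by (rule *(2)) (use assms in auto)
  then show "compose_diagrams (relabel_bottom \<sigma> a) (relabel_top \<sigma> b) = compose_diagrams a b"
    by (simp add: relabel_id)
qed

section \<open>Composition with the identity and with permutation diagrams\<close>

lemma partition_on_image:
  assumes "partition_on A P" "inj_on f A"
  shows "partition_on (f ` A) ((`) f ` P)"
proof -
  have "{} \<notin> (`) f ` P"
    using assms(1) by (auto simp: partition_on_def)
  then show ?thesis
    using partition_on_inj_image[OF assms] by simp
qed

lemma diagram_pairs:
  assumes "d \<in> diagrams n m"
  shows "partition_on ({0} \<times> {1..n} \<union> {1} \<times> {1..m}) d" "\<And>p. p \<in> d \<Longrightarrow> card p = 2"
  using assms by (auto simp: diagrams_def pair_partitions_def)

lemma diagram_pair_nonempty:
  assumes "d \<in> diagrams n m" "p \<in> d"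
  obtains r i where "(r, i) \<in> p"
  using diagram_pairs(2)[OF assms] by (metis card.empty ex_in_conv surj_pair zero_neq_numeral)

text \<open>After \<open>d\<close> is shifted down by one row, the identity hangs the leaf
  \<open>(0, i)\<close> on the middle node \<open>(1, i)\<close>. Every component is a pair of
  \<open>d\<close> with its leaves; it reaches an outer row, and its outer nodes give the pair
  back.\<close>

lemma compose_identity_left:
  assumes d: "d \<in> diagrams n m"
  shows "loops (perm_diagram n id) d = 0" "compose_diagrams (perm_diagram n id) d = d"
proof -
  define s :: "nat \<times> nat \<Rightarrow> nat \<times> nat" where "s = (\<lambda>(r, i). (Suc r, i))"
  define k :: "nat \<times> nat \<Rightarrow> nat \<times> nat" where "k = (\<lambda>(r, i). (0, i))"
  define V where "V = {1::nat} \<times> {1..n}"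
  define A where "A = {0::nat} \<times> {1..n} \<union> {1} \<times> {1..m}"
  define K where "K p = s ` p \<union> k ` (s ` p \<inter> V)" for p
  have [simp]: "s (r, i) = (Suc r, i)" "k (r, i) = (0, i)" for r i
    by (simp_all add: s_def k_def)
  have inj: "inj_on s X" for X
    by (auto simp: inj_on_def s_def)
  have s_iff: "(r, i) \<in> s ` X \<longleftrightarrow> (\<exists>q. r = Suc q \<and> (q, i) \<in> X)" for r i X
    by (force simp: s_def image_iff)
  have V: "V \<subseteq> s ` A" "k ` V \<inter> s ` A = {}" "inj_on k V"
    by (auto simp: V_def A_def s_iff inj_on_def)
  have stack: "stack (perm_diagram n id) d = (`) s ` d \<union> (\<lambda>v. {v, k v}) ` V"
  proof -
    have "V = Pair 1 ` {1..n}"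
      by (auto simp: V_def)
    then have "(\<lambda>v. {v, k v}) ` V = perm_diagram n id"
      by (simp add: image_image perm_diagram_def insert_commute)
    then show ?thesis
      by (simp add: stack_def s_def Un_commute)
  qed
  have "partition_on (s ` A) ((`) s ` d)"
    using partition_on_image[OF diagram_pairs(1)[OF d] inj] by (simp add: A_def)
  moreover have "card q = 2" if "q \<in> (`) s ` d" for q
    using that diagram_pairs(2)[OF d] by (auto simp: card_image[OF inj])
  ultimately have "components (stack (perm_diagram n id) d) = (\<lambda>q. q \<union> k ` (q \<inter> V)) ` (`) s ` d"
    unfolding stack using V by (intro components_pendant_edges)
  then have comps: "components (stack (perm_diagram n id) d) = K ` d"
    by (simp add: image_image K_def)
  have K_iff: "(r, i) \<in> K p \<longleftrightarrow> (\<exists>q. r = Suc q \<and> (q, i) \<in> p) \<or> r = 0 \<and> (0, i) \<in> p" if p: "p \<in> d" for p r i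
  proof -
    have "(r, i) \<in> k ` (s ` p \<inter> V) \<longleftrightarrow> r = 0 \<and> (0, i) \<in> p"
      using diagrams_rows[OF d p, of 0 i] by (force simp: V_def s_def k_def image_iff)
    then show ?thesis
      by (simp add: K_def s_iff)
  qed
  have "\<not> inner (K p)" if p: "p \<in> d" for p
  proof -
    obtain r i where ri: "(r, i) \<in> p"
      using diagram_pair_nonempty[OF d p] .
    \<comment> \<open>A node outside the middle row: the leaf of a top node, or the shifted copy of
      a bottom node.\<close>
    then have "(if r = 0 then 0 else Suc r, i) \<in> K p"
      by (auto simp: K_iff[OF p])
    then show ?thesis
      unfolding inner_def by (fastforce split: if_splits)
  qed
  moreover have "trace (K p) = p" if p: "p \<in> d" for p
  proof -
    have "(s, i) \<in> trace (K p) \<longleftrightarrow> (s, i) \<in> p" for s i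
    proof
      assume "(s, i) \<in> trace (K p)"
      then obtain r where "r \<noteq> 1" "s = r div 2" "(\<exists>q. r = Suc q \<and> (q, i) \<in> p) \<or> r = 0 \<and> (0, i) \<in> p"
        by (auto simp: trace_iff K_iff[OF p])
      then show "(s, i) \<in> p"
        using diagrams_rows[OF d p] by fastforce
    next
      assume si: "(s, i) \<in> p"
      then have "s = 0 \<or> s = 1"
        using diagrams_rows[OF d p] by blast
      then show "(s, i) \<in> trace (K p)"
        unfolding trace_iff K_iff[OF p] using si
        \<comment> \<open>Row \<open>s\<close> of the composite comes from row \<open>2 * s\<close>
          of the picture: row 0 from the leaves, row 1 from row 2.\<close>
        by (intro exI[of _ "2 * s"]) (auto simp: numeral_2_eq_2)
    qed
    then show ?thesis
      by auto
  qed
  ultimately show "loops (perm_diagram n id) d = 0" "compose_diagrams (perm_diagram n id) d = d"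
    using compose_diagrams_eqI[OF comps] by blast+
qed

lemma compose_identity_right:
  assumes d: "d \<in> diagrams n m"
  shows "loops d (perm_diagram m id) = 0" "compose_diagrams d (perm_diagram m id) = d"
proof -
  define k :: "nat \<times> nat \<Rightarrow> nat \<times> nat" where "k = (\<lambda>(r, i). (2, i))"
  define V where "V = {1::nat} \<times> {1..m}"
  define A where "A = {0::nat} \<times> {1..n} \<union> {1} \<times> {1..m}"
  define K where "K p = p \<union> k ` (p \<inter> V)" for p
  have V: "V \<subseteq> A" "k ` V \<inter> A = {}" "inj_on k V"
    by (auto simp: V_def A_def k_def inj_on_def)
  have stack: "stack d (perm_diagram m id) = d \<union> (\<lambda>v. {v, k v}) ` V"
  proof -
    have "(\<lambda>v. {v, k v}) ` V = (\<lambda>i. {(1, i), (2, i)}) ` {1..m}"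
      by (force simp: V_def k_def)
    then show ?thesis
      by (simp add: stack_def perm_diagram_def image_image numeral_2_eq_2)
  qed
  have comps: "components (stack d (perm_diagram m id)) = K ` d"
    unfolding stack K_def using V diagram_pairs[OF d] unfolding A_def by (intro components_pendant_edges)
  have K_iff: "(r, i) \<in> K p \<longleftrightarrow> (r, i) \<in> p \<or> r = 2 \<and> (1, i) \<in> p" if p: "p \<in> d" for p r i
  proof -
    have "(r, i) \<in> k ` (p \<inter> V) \<longleftrightarrow> r = 2 \<and> (1, i) \<in> p"
      using diagrams_rows[OF d p, of 1 i] by (force simp: V_def k_def image_iff)
    then show ?thesis
      by (simp add: K_def)
  qed
  have "\<not> inner (K p)" if p: "p \<in> d" for p
  proof -
    obtain r i where ri: "(r, i) \<in> p"
      using diagram_pair_nonempty[OF d p] .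
    then have "(if r = 0 then 0 else 2, i) \<in> K p"
      using diagrams_rows[OF d p ri] by (auto simp: K_iff[OF p])
    then show ?thesis
      unfolding inner_def by (fastforce split: if_splits)
  qed
  moreover have "trace (K p) = p" if p: "p \<in> d" for p
  proof -
    have "(s, i) \<in> trace (K p) \<longleftrightarrow> (s, i) \<in> p" for s i
    proof
      assume "(s, i) \<in> trace (K p)"
      then obtain r where "r \<noteq> 1" "s = r div 2" "(r, i) \<in> p \<or> r = 2 \<and> (1, i) \<in> p"
        by (auto simp: trace_iff K_iff[OF p])
      then show "(s, i) \<in> p"
        using diagrams_rows[OF d p] by fastforce
    next
      assume si: "(s, i) \<in> p"
      then have "s = 0 \<or> s = 1"
        using diagrams_rows[OF d p] by blast
      then show "(s, i) \<in> trace (K p)"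
        unfolding trace_iff K_iff[OF p] using si
        by (intro exI[of _ "2 * s"]) auto
    qed
    then show ?thesis
      by auto
  qed
  ultimately show "loops d (perm_diagram m id) = 0" "compose_diagrams d (perm_diagram m id) = d"
    using compose_diagrams_eqI[OF comps] by blast+
qed

text \<open>The two descriptions of one diagram, from the top and from the bottom, are what makes
  the left and the right action agree on the unit.\<close>

lemma perm_diagram_eq_relabel:
  assumes "\<sigma> \<in> perms n"
  shows "perm_diagram n \<sigma> = relabel_top \<sigma> (perm_diagram n id)"
    and "perm_diagram n \<sigma> = relabel_bottom (inv \<sigma>) (perm_diagram n id)"
proof -
  show "perm_diagram n \<sigma> = relabel_top \<sigma> (perm_diagram n id)"
    by (simp add: perm_diagram_def relabel_top_def image_image)
  have "relabel_bottom (inv \<sigma>) (perm_diagram n id) = (\<lambda>i. {(0, i), (1, inv \<sigma> i)}) ` {1..n}"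
    by (simp add: perm_diagram_def relabel_bottom_def image_image)
  also have "{1..n} = \<sigma> ` {1..n}"
    using assms by (simp add: perms_def permutes_image)
  also have "(\<lambda>i. {(0, i), (1, inv \<sigma> i)}) ` \<sigma> ` {1..n} = perm_diagram n \<sigma>"
    using assms by (simp add: perm_diagram_def image_image)
  finally show "perm_diagram n \<sigma> = relabel_bottom (inv \<sigma>) (perm_diagram n id)" ..
qed

lemma compose_perm_left:
  assumes "\<sigma> \<in> perms n" "d \<in> diagrams n m"
  shows "loops (perm_diagram n \<sigma>) d = 0" "compose_diagrams (perm_diagram n \<sigma>) d = relabel_top \<sigma> d"
  using compose_relabel_top[OF perms_bij[OF assms(1)], of "perm_diagram n id" d] compose_identity_left[OF assms(2)]
  by (simp_all add: perm_diagram_eq_relabel(1)[OF assms(1)])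

lemma inj_on_perm_diagram: "inj_on (perm_diagram n) (perms n)"
proof (rule inj_onI)
  fix \<sigma> \<tau> assume p: "\<sigma> \<in> perms n" "\<tau> \<in> perms n" and eq: "perm_diagram n \<sigma> = perm_diagram n \<tau>"
  show "\<sigma> = \<tau>"
  proof
    fix i
    show "\<sigma> i = \<tau> i"
    proof (cases "i \<in> {1..n}")
      case True
      then have "{(0, \<sigma> i), (1, i)} \<in> perm_diagram n \<sigma>"
        by (auto simp: perm_diagram_def)
      then have "{(0, \<sigma> i), (1, i)} \<in> perm_diagram n \<tau>"
        by (simp only: eq)
      then obtain j where "{(0, \<sigma> i), (1, i)} = {(0::nat, \<tau> j), (1, j)}"
        unfolding perm_diagram_def by blast
      then show ?thesis
        by (auto simp: doubleton_eq_iff)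
    next
      case False
      then show ?thesis
        using p by (simp add: perms_def permutes_def)
    qed
  qed
qed

lemma relabel_diagram_diagrams:
  assumes h: "\<And>r. h r permutes {1..n}" and d: "d \<in> diagrams n n"
  shows "relabel_diagram h d \<in> diagrams n n" "propagating (relabel_diagram h d) = propagating d"
proof -
  let ?A = "{0} \<times> {1..n} \<union> {1} \<times> {1..n}"
  have bij: "bij (relabel h)"
    by (rule bij_relabel) (rule permutes_bij[OF h])
  then have inj: "inj (relabel h)"
    by (rule bij_is_inj)
  have part: "partition_on ?A d" and pairs: "\<And>p. p \<in> d \<Longrightarrow> card p = 2"
    using d by (auto simp: diagrams_def pair_partitions_def)
  have A: "relabel h ` ?A = ?A"
  proof -
    have "relabel h ` ({r} \<times> {1..n}) = {r} \<times> {1..n}" for r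
    proof -
      have "relabel h ` ({r} \<times> {1..n}) = {r} \<times> (h r ` {1..n})"
        by (auto simp: relabel_def)
      then show ?thesis
        by (simp only: permutes_image[OF h])
    qed
    then show ?thesis
      by (simp only: image_Un)
  qed
  have "partition_on (relabel h ` ?A) (relabel_diagram h d)"
    by (rule partition_on_image[OF part]) (rule inj_on_subset[OF inj], simp)
  then have "partition_on ?A (relabel_diagram h d)"
    unfolding A .
  moreover have "card p = 2" if "p \<in> relabel_diagram h d" for p
    using that pairs inj by (auto simp: card_image inj_on_subset)
  ultimately show "relabel_diagram h d \<in> diagrams n n"
    by (simp add: diagrams_def pair_partitions_def)
  have *: "(\<exists>i j. relabel h ` p = {(0, i), (1, j)}) \<longleftrightarrow> (\<exists>i j. p = {(0, i), (1, j)})" for p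
  proof
    assume "\<exists>i j. relabel h ` p = {(0, i), (1, j)}"
    then obtain i j where "relabel h ` p = {(0, i), (1, j)}"
      by blast
    also have "\<dots> = relabel h ` {(0, inv (h 0) i), (1, inv (h 1) j)}"
      using permutes_inverses(1)[OF h] by simp
    finally have "p = {(0, inv (h 0) i), (1, inv (h 1) j)}"
      by (simp only: inj_image_eq_iff[OF inj])
    then show "\<exists>i j. p = {(0, i), (1, j)}"
      by blast
  next
    assume "\<exists>i j. p = {(0, i), (1, j)}"
    then show "\<exists>i j. relabel h ` p = {(0, i), (1, j)}"
      by fastforce
  qed
  have filter: "{p \<in> (`) (relabel h) ` X. Q p} = (`) (relabel h) ` {p \<in> X. Q (relabel h ` p)}" for X Q
    by blast
  have "{p \<in> relabel_diagram h d. \<exists>i j. p = {(0, i), (1, j)}} =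
      relabel_diagram h {p \<in> d. \<exists>i j. p = {(0, i), (1, j)}}"
    unfolding filter * ..
  moreover have "inj ((`) (relabel h))"
    by (rule injI) (simp add: inj_image_eq_iff[OF inj])
  ultimately show "propagating (relabel_diagram h d) = propagating d"
    unfolding propagating_def by (simp add: card_image inj_on_subset)
qed

lemma relabel_top_diagrams:
  assumes "\<sigma> \<in> perms n" "d \<in> diagrams n n"
  shows "relabel_top \<sigma> d \<in> diagrams n n" "propagating (relabel_top \<sigma> d) = propagating d"
proof -
  have "(if r = 0 then \<sigma> else id) permutes {1..n}" for r :: nat
    using assms(1) by (simp add: perms_def permutes_id)
  from relabel_diagram_diagrams[where h = "\<lambda>r. if r = 0 then \<sigma> else id", OF this assms(2)]
  show "relabel_top \<sigma> d \<in> diagrams n n" "propagating (relabel_top \<sigma> d) = propagating d"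
    unfolding relabel_top_def by blast+
qed

lemma relabel_bottom_diagrams:
  assumes "\<sigma> \<in> perms n" "d \<in> diagrams n n"
  shows "relabel_bottom \<sigma> d \<in> diagrams n n" "propagating (relabel_bottom \<sigma> d) = propagating d"
proof -
  have "(if r = 0 then id else \<sigma>) permutes {1..n}" for r :: nat
    using assms(1) by (simp add: perms_def permutes_id)
  from relabel_diagram_diagrams[where h = "\<lambda>r. if r = 0 then id else \<sigma>", OF this assms(2)]
  show "relabel_bottom \<sigma> d \<in> diagrams n n" "propagating (relabel_bottom \<sigma> d) = propagating d"
    unfolding relabel_bottom_def by blast+
qed

lemma identity_diagram:
  "perm_diagram n id \<in> diagrams n n" "propagating (perm_diagram n id) = n"
proof -
  show "perm_diagram n id \<in> diagrams n n"
    unfolding diagrams_def pair_partitions_def partition_on_def disjoint_def perm_diagram_def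
    by (auto simp: doubleton_eq_iff)
  have "{p \<in> perm_diagram n id. \<exists>i j. p = {(0, i), (1, j)}} = (\<lambda>i. {(0, i), (1, i)}) ` {1..n}"
    by (auto simp: perm_diagram_def)
  moreover have "inj_on (\<lambda>i. {(0::nat, i), (1, i)}) {1..n}"
    by (auto simp: inj_on_def doubleton_eq_iff)
  ultimately show "propagating (perm_diagram n id) = n"
    unfolding propagating_def by (simp add: card_image)
qed

lemma perm_diagram_diagrams:
  assumes "\<sigma> \<in> perms n"
  shows "perm_diagram n \<sigma> \<in> diagrams n n" "propagating (perm_diagram n \<sigma>) = n"
  using relabel_top_diagrams[OF assms identity_diagram(1)] identity_diagram(2)
  by (simp_all add: perm_diagram_eq_relabel(1)[OF assms])

lemma relabel_top_perm_diagram: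
  "relabel_top \<tau> (perm_diagram n \<sigma>) = perm_diagram n (\<tau> \<circ> \<sigma>)"
  by (simp add: perm_diagram_def relabel_top_def image_image)

lemma relabel_bottom_perm_diagram:
  assumes "\<sigma> \<in> perms n" "\<tau> \<in> perms n"
  shows "relabel_bottom \<tau> (perm_diagram n \<sigma>) = perm_diagram n (\<sigma> \<circ> inv \<tau>)"
proof -
  have "relabel_bottom \<tau> (perm_diagram n \<sigma>) = relabel_top \<sigma> (relabel_bottom \<tau> (perm_diagram n id))"
    unfolding perm_diagram_eq_relabel(1)[OF assms(1)] relabel_top_bottom ..
  also have "relabel_bottom \<tau> (perm_diagram n id) = perm_diagram n (inv \<tau>)"
    using perm_diagram_eq_relabel(2)[OF perms_inv[OF assms(2)]] assms(2) by simp
  finally show ?thesis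
    by (simp add: relabel_top_perm_diagram)
qed

lemma finite_diagrams: "finite (diagrams n m)"
proof -
  have "diagrams n m \<subseteq> Pow (Pow ({0} \<times> {1..n} \<union> {1} \<times> {1..m}))"
    by (auto simp: diagrams_def pair_partitions_def partition_on_def)
  then show ?thesis
    by (rule finite_subset) simp
qed

text \<open>A top node without propagating line is joined to another such top node, so the number of
  propagating lines is never \<open>n - 1\<close>.\<close>

lemma perm_diagram_or_propagating_le:
  assumes d: "d \<in> diagrams n n"
  shows "(\<exists>\<sigma>\<in>perms n. d = perm_diagram n \<sigma>) \<or> propagating d \<le> n - 2"
proof -
  let ?A = "{0} \<times> {1..n} \<union> {1} \<times> {1..n}"
  define P where "P = {p \<in> d. \<exists>i j. p = {(0, i), (1, j)}}"
  have part: "partition_on ?A d" and pairs: "\<And>p. p \<in> d \<Longrightarrow> card p = 2"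
    using d by (auto simp: diagrams_def pair_partitions_def)
  have union: "\<Union>d = ?A"
    using part by (simp add: partition_on_def)
  have same: "p = q" if "p \<in> d" "q \<in> d" "x \<in> p" "x \<in> q" for p q x
    using part that by (auto simp: partition_on_def disjoint_def)
  show ?thesis
  proof (cases "\<forall>i\<in>{1..n}. \<exists>j. {(0, i), (1, j)} \<in> d")
    case True
    then obtain s where s: "\<And>i. i \<in> {1..n} \<Longrightarrow> {(0, i), (1, s i)} \<in> d"
      by metis
    have s_in: "s i \<in> {1..n}" if "i \<in> {1..n}" for i
      using diagrams_rows[OF d s[OF that], of 1 "s i"] by simp
    have "inj_on s {1..n}"
    proof (rule inj_onI)
      fix i j assume ij: "i \<in> {1..n}" "j \<in> {1..n}" "s i = s j"
      have "{(0::nat, i), (1, s i)} = {(0, j), (1, s j)}"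
        by (rule same[OF s[OF ij(1)] s[OF ij(2)], of "(1, s i)"]) (simp_all add: ij(3))
      then show "i = j"
        by (auto simp: doubleton_eq_iff)
    qed
    then have s_bij: "bij_betw s {1..n} {1..n}"
      using s_in by (intro bij_betw_imageI endo_inj_surj) auto
    define \<tau> where "\<tau> i = (if i \<in> {1..n} then s i else i)" for i
    have "bij_betw \<tau> {1..n} {1..n}"
      using s_bij by (subst bij_betw_cong[of _ _ s]) (simp_all add: \<tau>_def)
    then have "\<tau> permutes {1..n}"
      by (rule bij_imp_permutes) (auto simp: \<tau>_def)
    then have t: "\<tau> \<in> perms n"
      by (simp add: perms_def)
    have "d = (\<lambda>i. {(0, i), (1, s i)}) ` {1..n}"
    proof
      show "(\<lambda>i. {(0, i), (1, s i)}) ` {1..n} \<subseteq> d"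
        using s by blast
      show "d \<subseteq> (\<lambda>i. {(0, i), (1, s i)}) ` {1..n}"
      proof
        fix p assume p: "p \<in> d"
        then obtain r k where rk: "(r, k) \<in> p"
          using part unfolding partition_on_def by (metis ex_in_conv surj_pair)
        have "\<exists>i\<in>{1..n}. (r, k) \<in> {(0, i), (1, s i)}"
          using diagrams_rows[OF d p rk] s_bij by (auto simp: bij_betw_def image_iff)
        then obtain i where "i \<in> {1..n}" "(r, k) \<in> {(0, i), (1, s i)}"
          by blast
        then show "p \<in> (\<lambda>i. {(0, i), (1, s i)}) ` {1..n}"
          using same[OF p s rk] by blast
      qed
    qed
    also have "\<dots> = (\<lambda>i. {(0, i), (1, \<tau> i)}) ` {1..n}"
      by (intro image_cong) (simp_all add: \<tau>_def)
    also have "\<dots> = relabel_bottom \<tau> (perm_diagram n id)"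
      by (simp add: perm_diagram_def relabel_bottom_def image_image)
    \<comment> \<open>\<open>s\<close> leads from top nodes to bottom nodes, whereas
      \<open>perm_diagram\<close> is indexed from bottom to top; hence the inverse.\<close>
    also have "\<dots> = perm_diagram n (inv \<tau>)"
      using perm_diagram_eq_relabel(2)[OF perms_inv[OF t]] t by simp
    finally show ?thesis
      using t by (intro disjI1 bexI[of _ "inv \<tau>"]) auto
  next
    case False
    then obtain i where i: "i \<in> {1..n}" "\<And>j. {(0, i), (1, j)} \<notin> d"
      by blast
    then obtain p where p: "p \<in> d" "(0, i) \<in> p"
      using union by blast
    have "\<exists>y. p = {(0, i), y} \<and> y \<noteq> (0, i)"
      using pairs[OF p(1)] p(2) unfolding card_2_iff by auto
    then obtain r k where rk: "p = {(0, i), (r, k)}" "(r, k) \<noteq> (0, i)"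
      by (metis surj_pair)
    then have "r = 0" "k \<in> {1..n}" "k \<noteq> i"
      using diagrams_rows[OF d p(1), of r k] i(2) p(1) by auto
    \<comment> \<open>The top end of a propagating line. It maps \<open>P\<close> injectively into
      the top nodes other than \<open>i\<close> and \<open>k\<close>.\<close>
    define f where "f q = (THE j. (0, j) \<in> q)" for q :: "(nat \<times> nat) set"
    have f: "f {(0, a), (1, b)} = a" for a b :: nat
      unfolding f_def by (rule the_equality) auto
    have "inj_on f P"
    proof (rule inj_onI)
      fix q q' assume q: "q \<in> P" "q' \<in> P" "f q = f q'"
      then obtain a b a' b' where ab: "q = {(0, a), (1, b)}" "q' = {(0, a'), (1, b')}"
        unfolding P_def by blast
      have "a = a'"
        using q(3) unfolding ab f .
      with ab q show "q = q'"
        by (intro same[of q q' "(0, a)"]) (simp_all add: P_def)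
    qed
    moreover have "f ` P \<subseteq> {1..n} - {i, k}"
    proof
      fix a assume "a \<in> f ` P"
      then obtain a' b where b': "{(0, a'), (1, b)} \<in> d" "a = f {(0, a'), (1, b)}"
        unfolding P_def by blast
      then have b: "{(0, a), (1, b)} \<in> d"
        unfolding f by simp
      have "a \<in> {1..n}"
        using diagrams_rows[OF d b, of 0 a] by simp
      moreover have "a \<noteq> i"
        using b i(2) by blast
      moreover have "a \<noteq> k"
      proof
        assume "a = k"
        then have "{(0, a), (1, b)} = p"
          using same[OF b p(1), of "(0, k)"] rk \<open>r = 0\<close> by simp
        then show False
          using rk \<open>r = 0\<close> by (auto simp: doubleton_eq_iff)
      qed
      ultimately show "a \<in> {1..n} - {i, k}"
        by blast
    qed
    ultimately have "card P \<le> card ({1..n} - {i, k})"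
      by (metis card_image card_mono finite_Diff finite_atLeastAtMost)
    also have "\<dots> = n - 2"
      using i(1) \<open>k \<in> {1..n}\<close> \<open>k \<noteq> i\<close> by (simp add: card_Diff_subset)
    finally show ?thesis
      by (simp add: P_def propagating_def)
  qed
qed

section \<open>Splitting idempotents of the Brauer algebra\<close>

definition brauer_mult ::
    "nat \<Rightarrow> 'k::field \<Rightarrow> (diagram \<Rightarrow> 'k) \<Rightarrow> (diagram \<Rightarrow> 'k) \<Rightarrow> diagram \<Rightarrow> 'k" where
  "brauer_mult n \<delta> x y = (\<lambda>c. \<Sum>a\<in>diagrams n n. \<Sum>b\<in>diagrams n n.
     if compose_diagrams a b = c then x a * y b * \<delta> ^ loops a b else 0)"

definition one_diagram :: "nat \<Rightarrow> diagram \<Rightarrow> 'k::field" where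
  "one_diagram n = single (perm_diagram n id)"

lemma brauer_algebra_simps:
  "x \<in> carrier (brauer_algebra n \<delta>) \<longleftrightarrow> (\<forall>d. d \<notin> diagrams n n \<longrightarrow> x d = 0)"
  "x \<otimes>\<^bsub>brauer_algebra n \<delta>\<^esub> y = brauer_mult n \<delta> x y"
  "\<one>\<^bsub>brauer_algebra n \<delta>\<^esub> = one_diagram n"
  "\<zero>\<^bsub>brauer_algebra n \<delta>\<^esub> = (\<lambda>_. 0)"
  "x \<oplus>\<^bsub>brauer_algebra n \<delta>\<^esub> y = (\<lambda>d. x d + y d)"
  by (simp_all add: brauer_algebra_def twisted_algebra_def brauer_mult_def one_diagram_def single_def)

text \<open>The ring axioms for the Brauer algebra are not established in this development, so the
  definite description behind \<open>a_inv\<close> is evaluated directly.\<close>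

lemma brauer_algebra_minus:
  assumes "y \<in> carrier (brauer_algebra n \<delta>)"
  shows "x \<ominus>\<^bsub>brauer_algebra n \<delta>\<^esub> y = (\<lambda>d. x d - y d)"
proof -
  let ?B = "brauer_algebra n \<delta>"
  have "a_inv ?B y = (\<lambda>d. - y d)"
    unfolding a_inv_def m_inv_def
  proof (rule the_equality, goal_cases)
    case 1
    then show ?case
      using assms by (simp add: brauer_algebra_simps)
  next
    case (2 z)
    then have "(\<lambda>d. y d + z d) = (\<lambda>_. 0)"
      by (simp add: brauer_algebra_simps)
    then have "y d + z d = 0" for d
      by (rule fun_cong)
    then show ?case
      by (simp add: fun_eq_iff add_eq_0_iff)
  qed
  then show ?thesis
    by (simp add: a_minus_def brauer_algebra_simps)
qed

section \<open>Bilinearity of the product\<close>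

lemma brauer_mult_add_left: "brauer_mult n \<delta> (\<lambda>d. x d + y d) z = (\<lambda>c. brauer_mult n \<delta> x z c + brauer_mult n \<delta> y z c)"
  unfolding brauer_mult_def sum.distrib[symmetric] by (intro ext sum.cong refl) (simp add: algebra_simps)

lemma brauer_mult_add_right: "brauer_mult n \<delta> z (\<lambda>d. x d + y d) = (\<lambda>c. brauer_mult n \<delta> z x c + brauer_mult n \<delta> z y c)"
  unfolding brauer_mult_def sum.distrib[symmetric] by (intro ext sum.cong refl) (simp add: algebra_simps)

lemma brauer_mult_diff_left: "brauer_mult n \<delta> (\<lambda>d. x d - y d) z = (\<lambda>c. brauer_mult n \<delta> x z c - brauer_mult n \<delta> y z c)"
  unfolding brauer_mult_def sum_subtractf[symmetric] by (intro ext sum.cong refl) (simp add: algebra_simps)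

lemma brauer_mult_diff_right: "brauer_mult n \<delta> z (\<lambda>d. x d - y d) = (\<lambda>c. brauer_mult n \<delta> z x c - brauer_mult n \<delta> z y c)"
  unfolding brauer_mult_def sum_subtractf[symmetric] by (intro ext sum.cong refl) (simp add: algebra_simps)

lemma brauer_mult_sum_left:
  "brauer_mult n \<delta> (\<lambda>d. \<Sum>\<sigma>\<in>S. x \<sigma> * f \<sigma> d) z = (\<lambda>c. \<Sum>\<sigma>\<in>S. x \<sigma> * brauer_mult n \<delta> (f \<sigma>) z c)"
proof
  fix c
  have "brauer_mult n \<delta> (\<lambda>d. \<Sum>\<sigma>\<in>S. x \<sigma> * f \<sigma> d) z c = (\<Sum>a\<in>diagrams n n. \<Sum>b\<in>diagrams n n. \<Sum>\<sigma>\<in>S.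
      x \<sigma> * (if compose_diagrams a b = c then f \<sigma> a * z b * \<delta> ^ loops a b else 0))"
    unfolding brauer_mult_def by (intro sum.cong refl) (simp add: sum_distrib_right mult.assoc)
  also have "\<dots> = (\<Sum>a\<in>diagrams n n. \<Sum>\<sigma>\<in>S. \<Sum>b\<in>diagrams n n.
      x \<sigma> * (if compose_diagrams a b = c then f \<sigma> a * z b * \<delta> ^ loops a b else 0))"
    by (rule sum.cong[OF refl]) (rule sum.swap)
  also have "\<dots> = (\<Sum>\<sigma>\<in>S. x \<sigma> * brauer_mult n \<delta> (f \<sigma>) z c)"
    unfolding brauer_mult_def sum_distrib_left by (rule sum.swap)
  finally show "brauer_mult n \<delta> (\<lambda>d. \<Sum>\<sigma>\<in>S. x \<sigma> * f \<sigma> d) z c = (\<Sum>\<sigma>\<in>S. x \<sigma> * brauer_mult n \<delta> (f \<sigma>) z c)" .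
qed

lemma brauer_mult_sum_right:
  "brauer_mult n \<delta> z (\<lambda>d. \<Sum>\<sigma>\<in>S. x \<sigma> * f \<sigma> d) = (\<lambda>c. \<Sum>\<sigma>\<in>S. x \<sigma> * brauer_mult n \<delta> z (f \<sigma>) c)"
proof
  fix c
  have "brauer_mult n \<delta> z (\<lambda>d. \<Sum>\<sigma>\<in>S. x \<sigma> * f \<sigma> d) c = (\<Sum>a\<in>diagrams n n. \<Sum>b\<in>diagrams n n. \<Sum>\<sigma>\<in>S.
      x \<sigma> * (if compose_diagrams a b = c then z a * f \<sigma> b * \<delta> ^ loops a b else 0))"
    unfolding brauer_mult_def
    by (intro sum.cong refl) (simp add: sum_distrib_right sum_distrib_left mult_ac)
  also have "\<dots> = (\<Sum>a\<in>diagrams n n. \<Sum>\<sigma>\<in>S. \<Sum>b\<in>diagrams n n.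
      x \<sigma> * (if compose_diagrams a b = c then z a * f \<sigma> b * \<delta> ^ loops a b else 0))"
    by (rule sum.cong[OF refl]) (rule sum.swap)
  also have "\<dots> = (\<Sum>\<sigma>\<in>S. x \<sigma> * brauer_mult n \<delta> z (f \<sigma>) c)"
    unfolding brauer_mult_def sum_distrib_left by (rule sum.swap)
  finally show "brauer_mult n \<delta> z (\<lambda>d. \<Sum>\<sigma>\<in>S. x \<sigma> * f \<sigma> d) c = (\<Sum>\<sigma>\<in>S. x \<sigma> * brauer_mult n \<delta> z (f \<sigma>) c)" .
qed

lemma relabel_top_inv_eq_iff: "bij \<sigma> \<Longrightarrow> relabel_top (inv \<sigma>) d = d' \<longleftrightarrow> d = relabel_top \<sigma> d'"
  by (metis relabel_top_inv)

lemma relabel_bottom_eq_iff: "bij \<sigma> \<Longrightarrow> relabel_bottom \<sigma> d = d' \<longleftrightarrow> d = relabel_bottom (inv \<sigma>) d'"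
  by (metis relabel_bottom_inv)

lemma sum_relabel_top:
  assumes "\<sigma> \<in> perms n"
  shows "(\<Sum>d\<in>diagrams n n. g d) = (\<Sum>d\<in>diagrams n n. g (relabel_top \<sigma> d))"
  using assms
  by (intro sum.reindex_bij_witness[of _ "relabel_top \<sigma>" "relabel_top (inv \<sigma>)"])
     (simp_all add: relabel_top_diagrams perms_bij)

lemma sum_relabel_bottom:
  assumes "\<sigma> \<in> perms n"
  shows "(\<Sum>d\<in>diagrams n n. g d) = (\<Sum>d\<in>diagrams n n. g (relabel_bottom \<sigma> d))"
  using assms
  by (intro sum.reindex_bij_witness[of _ "relabel_bottom \<sigma>" "relabel_bottom (inv \<sigma>)"])
     (simp_all add: relabel_bottom_diagrams perms_bij)

section \<open>The left and right actions of the group algebra\<close>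

abbreviation left_act ::
    "nat \<Rightarrow> ((nat \<Rightarrow> nat) \<Rightarrow> 'k::field) \<Rightarrow> (diagram \<Rightarrow> 'k) \<Rightarrow> diagram \<Rightarrow> 'k" where
  "left_act n \<equiv> lin_act n relabel_top"

text \<open>Right multiplication by \<open>x\<close>. A permutation \<open>\<sigma>\<close> relabels
  the bottom row by \<open>inv \<sigma>\<close>, and passing to coefficient functions inverts once
  more, so \<open>\<sigma>\<close> itself appears here.\<close>

definition right_act ::
    "nat \<Rightarrow> ((nat \<Rightarrow> nat) \<Rightarrow> 'k::field) \<Rightarrow> (diagram \<Rightarrow> 'k) \<Rightarrow> diagram \<Rightarrow> 'k" where
  "right_act n x v = (\<lambda>d. \<Sum>\<sigma>\<in>perms n. x \<sigma> * v (relabel_bottom \<sigma> d))"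

text \<open>The three lemmas below are the instances of associativity of the Brauer algebra in which one
  factor is a permutation.  They hold by relabelling alone; the remaining instances are not needed,
  because a splitting idempotent kills the ideal.\<close>

lemma brauer_mult_left_act: "brauer_mult n \<delta> (left_act n x v) w = left_act n x (brauer_mult n \<delta> v w)"
proof -
  have "brauer_mult n \<delta> (\<lambda>d. v (relabel_top (inv \<sigma>) d)) w c = brauer_mult n \<delta> v w (relabel_top (inv \<sigma>) c)"
    if s: "\<sigma> \<in> perms n" for \<sigma> c
  proof -
    have "compose_diagrams (relabel_top \<sigma> a) b = c \<longleftrightarrow> compose_diagrams a b = relabel_top (inv \<sigma>) c" for a b
      unfolding compose_relabel_top(2)[OF perms_bij[OF s]]
      using relabel_top_inv_eq_iff[OF perms_bij[OF s]] by metis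
    note iff = this
    show ?thesis
      unfolding brauer_mult_def
      by (rule trans[OF sum_relabel_top[OF s]], intro sum.cong refl)
         (simp add: iff perms_bij[OF s] compose_relabel_top(1))
  qed
  then show ?thesis
    unfolding lin_act_def brauer_mult_sum_left by simp
qed

lemma brauer_mult_right_act: "brauer_mult n \<delta> v (right_act n x w) = right_act n x (brauer_mult n \<delta> v w)"
proof -
  have "brauer_mult n \<delta> v (\<lambda>d. w (relabel_bottom \<sigma> d)) c = brauer_mult n \<delta> v w (relabel_bottom \<sigma> c)"
    if s: "\<sigma> \<in> perms n" for \<sigma> c
  proof -
    have bij: "bij (inv \<sigma>)" "bij \<sigma>"
      using s by (simp_all add: perms_bij[of _ n])
    have "compose_diagrams a (relabel_bottom (inv \<sigma>) b) = c \<longleftrightarrow> compose_diagrams a b = relabel_bottom \<sigma> c"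
      if "a \<in> diagrams n n" for a b
      unfolding compose_relabel_bottom(2)[OF bij(1) that] using relabel_bottom_eq_iff[OF bij(2)] by metis
    note iff = this
    show ?thesis
      unfolding brauer_mult_def
      by (rule sum.cong[OF refl], rule trans[OF sum_relabel_bottom[OF perms_inv[OF s]]], rule sum.cong[OF refl])
         (simp add: iff bij compose_relabel_bottom(1)[OF bij(1)])
  qed
  then show ?thesis
    unfolding right_act_def brauer_mult_sum_right by simp
qed

lemma brauer_mult_middle: "brauer_mult n \<delta> (right_act n x v) w = brauer_mult n \<delta> v (left_act n x w)"
proof -
  have "brauer_mult n \<delta> (\<lambda>d. v (relabel_bottom \<sigma> d)) w c = brauer_mult n \<delta> v (\<lambda>d. w (relabel_top (inv \<sigma>) d)) c"
    if s: "\<sigma> \<in> perms n" for \<sigma> c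
  proof -
    have bij: "bij (inv \<sigma>)" "bij \<sigma>"
      using s by (simp_all add: perms_bij[of _ n])
    show ?thesis
      unfolding brauer_mult_def
      by (rule trans[OF sum_relabel_bottom[OF perms_inv[OF s]]], rule sum.cong[OF refl],
          rule trans[OF sum_relabel_top[OF perms_inv[OF s]]], rule sum.cong[OF refl])
         (simp add: bij compose_relabel_middle[OF bij(1)])
  qed
  then show ?thesis
    unfolding right_act_def lin_act_def brauer_mult_sum_left brauer_mult_sum_right by simp
qed

lemma right_left_act: "right_act n y (left_act n x v) = left_act n x (right_act n y v)"
proof
  fix d
  have "right_act n y (left_act n x v) d =
      (\<Sum>\<tau>\<in>perms n. \<Sum>\<sigma>\<in>perms n. y \<tau> * (x \<sigma> * v (relabel_top (inv \<sigma>) (relabel_bottom \<tau> d))))"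
    by (simp add: right_act_def lin_act_def sum_distrib_left)
  also have "\<dots> = (\<Sum>\<sigma>\<in>perms n. \<Sum>\<tau>\<in>perms n. y \<tau> * (x \<sigma> * v (relabel_top (inv \<sigma>) (relabel_bottom \<tau> d))))"
    by (rule sum.swap)
  also have "\<dots> = left_act n x (right_act n y v) d"
    by (simp add: right_act_def lin_act_def sum_distrib_left relabel_top_bottom mult.left_commute)
  finally show "right_act n y (left_act n x v) d = left_act n x (right_act n y v) d" .
qed

lemma right_act_zero: "right_act n x (\<lambda>_. 0) = (\<lambda>_. 0)"
  by (simp add: right_act_def)

lemma right_act_add: "right_act n x (\<lambda>d. v d + w d) = (\<lambda>d. right_act n x v d + right_act n x w d)"
  by (simp add: right_act_def sum.distrib distrib_left)

lemma brauer_mult_one_left: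
  assumes "\<And>d. d \<notin> diagrams n n \<Longrightarrow> w d = 0"
  shows "brauer_mult n \<delta> (one_diagram n) w = w"
proof
  fix c
  have "(\<Sum>b\<in>diagrams n n. if compose_diagrams a b = c then one_diagram n a * w b * \<delta> ^ loops a b else 0) =
      (if a = perm_diagram n id then w c else 0)" for a
  proof (cases "a = perm_diagram n id")
    case True
    have "(\<Sum>b\<in>diagrams n n. if compose_diagrams a b = c then one_diagram n a * w b * \<delta> ^ loops a b else 0) =
        (\<Sum>b\<in>diagrams n n. if b = c then w b else 0)"
    proof (rule sum.cong[OF refl])
      fix b assume "b \<in> diagrams n n"
      note b = compose_identity_left[OF this]
      show "(if compose_diagrams a b = c then one_diagram n a * w b * \<delta> ^ loops a b else 0) =
          (if b = c then w b else 0)"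
        unfolding True b by (simp add: one_diagram_def single_def)
    qed
    also have "\<dots> = w c"
      using assms by (simp add: finite_diagrams)
    finally show ?thesis
      using True by simp
  qed (simp add: one_diagram_def single_def cong: if_cong)
  then show "brauer_mult n \<delta> (one_diagram n) w c = w c"
    by (simp add: brauer_mult_def finite_diagrams identity_diagram)
qed

lemma brauer_mult_one_right:
  assumes "\<And>d. d \<notin> diagrams n n \<Longrightarrow> w d = 0"
  shows "brauer_mult n \<delta> w (one_diagram n) = w"
proof
  fix c
  have "(\<Sum>b\<in>diagrams n n. if compose_diagrams a b = c then w a * one_diagram n b * \<delta> ^ loops a b else 0) =
      (if a = c then w c else 0)" if a: "a \<in> diagrams n n" for a
  proof -
    have "(\<Sum>b\<in>diagrams n n. if compose_diagrams a b = c then w a * one_diagram n b * \<delta> ^ loops a b else 0) =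
        (\<Sum>b\<in>diagrams n n. if b = perm_diagram n id then if a = c then w a else 0 else 0)"
    proof (rule sum.cong[OF refl])
      fix b
      show "(if compose_diagrams a b = c then w a * one_diagram n b * \<delta> ^ loops a b else 0) =
          (if b = perm_diagram n id then if a = c then w a else 0 else 0)"
      proof (cases "b = perm_diagram n id")
        case True
        show ?thesis
          unfolding True compose_identity_right[OF a] by (simp add: one_diagram_def single_def)
      qed (simp add: one_diagram_def single_def)
    qed
    also have "\<dots> = (if a = c then w c else 0)"
      by (simp add: finite_diagrams identity_diagram)
    finally show ?thesis .
  qed
  then show "brauer_mult n \<delta> w (one_diagram n) c = w c"
    using assms by (simp add: brauer_mult_def finite_diagrams)
qed

lemma left_act_one: "left_act n x (one_diagram n) d = (\<Sum>\<sigma> | \<sigma> permutes {1..n} \<and> perm_diagram n \<sigma> = d. x \<sigma>)"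
proof -
  have "relabel_top (inv \<sigma>) d = perm_diagram n id \<longleftrightarrow> perm_diagram n \<sigma> = d" if "\<sigma> \<in> perms n" for \<sigma>
    unfolding relabel_top_inv_eq_iff[OF perms_bij[OF that]] perm_diagram_eq_relabel(1)[OF that] by (rule eq_commute)
  then have "left_act n x (one_diagram n) d = (\<Sum>\<sigma>\<in>perms n. if perm_diagram n \<sigma> = d then x \<sigma> else 0)"
    unfolding lin_act_def by (intro sum.cong) (auto simp: one_diagram_def single_def)
  also have "\<dots> = (\<Sum>\<sigma> | \<sigma> \<in> perms n \<and> perm_diagram n \<sigma> = d. x \<sigma>)"
    by (rule sum.inter_filter[symmetric]) simp
  finally show ?thesis
    by (simp add: perms_def)
qed

lemma right_act_one: "right_act n x (one_diagram n) = left_act n x (one_diagram n)"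
proof
  fix d
  have "relabel_bottom \<sigma> d = perm_diagram n id \<longleftrightarrow> relabel_top (inv \<sigma>) d = perm_diagram n id" if s: "\<sigma> \<in> perms n" for \<sigma>
  proof -
    have "relabel_bottom \<sigma> d = perm_diagram n id \<longleftrightarrow> d = relabel_bottom (inv \<sigma>) (perm_diagram n id)"
      by (rule relabel_bottom_eq_iff[OF perms_bij[OF s]])
    also have "\<dots> \<longleftrightarrow> d = relabel_top \<sigma> (perm_diagram n id)"
      using perm_diagram_eq_relabel[OF s] by simp
    also have "\<dots> \<longleftrightarrow> relabel_top (inv \<sigma>) d = perm_diagram n id"
      by (rule relabel_top_inv_eq_iff[OF perms_bij[OF s], symmetric])
    finally show ?thesis .
  qed
  then show "right_act n x (one_diagram n) d = left_act n x (one_diagram n) d"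
    unfolding right_act_def lin_act_def by (intro sum.cong) (simp_all add: one_diagram_def single_def)
qed

lemma left_act_one_perm:
  assumes "\<sigma> \<in> perms n"
  shows "left_act n x (one_diagram n) (perm_diagram n \<sigma>) = x \<sigma>"
proof -
  have "{\<tau>. \<tau> permutes {1..n} \<and> perm_diagram n \<tau> = perm_diagram n \<sigma>} = {\<sigma>}"
    using inj_on_perm_diagram assms by (auto simp: inj_on_def perms_def)
  then show ?thesis
    by (simp add: left_act_one)
qed

lemma left_act_one_outside:
  assumes "\<And>\<sigma>. \<sigma> \<in> perms n \<Longrightarrow> d \<noteq> perm_diagram n \<sigma>"
  shows "left_act n x (one_diagram n) d = 0"
proof -
  have "{\<sigma>. \<sigma> permutes {1..n} \<and> perm_diagram n \<sigma> = d} = {}"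
    using assms unfolding perms_def by blast
  then show ?thesis
    unfolding left_act_one by (simp only: sum.empty)
qed

lemma embed_perms_eq: "embed_perms n x = left_act n (\<lambda>\<sigma>. of_rat (x \<sigma>)) (one_diagram n)"
  by (simp add: fun_eq_iff embed_perms_def left_act_one)

section \<open>The ideal and its complement, the group algebra\<close>

lemma brauer_ideal_left_act:
  assumes "v \<in> brauer_ideal n k"
  shows "left_act n x v \<in> brauer_ideal n k"
  unfolding brauer_ideal_def
proof (intro CollectI allI impI)
  fix d assume "left_act n x v d \<noteq> 0"
  then obtain \<sigma> where "\<sigma> \<in> perms n" "x \<sigma> * v (relabel_top (inv \<sigma>) d) \<noteq> 0"
    unfolding lin_act_def by (rule sum.not_neutral_contains_not_neutral)
  then have s: "\<sigma> \<in> perms n" "v (relabel_top (inv \<sigma>) d) \<noteq> 0"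
    by auto
  then have "relabel_top (inv \<sigma>) d \<in> diagrams n n" "propagating (relabel_top (inv \<sigma>) d) \<le> k"
    using assms by (auto simp: brauer_ideal_def)
  with relabel_top_diagrams[OF s(1) this(1)] show "d \<in> diagrams n n \<and> propagating d \<le> k"
    by (simp add: perms_bij[OF s(1)])
qed

lemma brauer_ideal_right_act:
  assumes "v \<in> brauer_ideal n k"
  shows "right_act n x v \<in> brauer_ideal n k"
  unfolding brauer_ideal_def
proof (intro CollectI allI impI)
  fix d assume "right_act n x v d \<noteq> 0"
  then obtain \<sigma> where "\<sigma> \<in> perms n" "x \<sigma> * v (relabel_bottom \<sigma> d) \<noteq> 0"
    unfolding right_act_def by (rule sum.not_neutral_contains_not_neutral)
  then have s: "\<sigma> \<in> perms n" "v (relabel_bottom \<sigma> d) \<noteq> 0"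
    by auto
  then have "relabel_bottom \<sigma> d \<in> diagrams n n" "propagating (relabel_bottom \<sigma> d) \<le> k"
    using assms by (auto simp: brauer_ideal_def)
  with relabel_bottom_diagrams[OF perms_inv[OF s(1)] this(1)] show "d \<in> diagrams n n \<and> propagating d \<le> k"
    by (simp add: perms_bij[OF s(1)])
qed

lemma brauer_ideal_outside: "v \<in> brauer_ideal n k \<Longrightarrow> d \<notin> diagrams n n \<Longrightarrow> v d = 0"
  by (auto simp: brauer_ideal_def)

lemma brauer_ideal_perm:
  assumes "v \<in> brauer_ideal n (n - 2)" "n \<ge> 2" "\<sigma> \<in> perms n"
  shows "v (perm_diagram n \<sigma>) = 0"
  using assms perm_diagram_diagrams(2)[OF assms(3)] by (fastforce simp: brauer_ideal_def)

text \<open>Subtracting the part of \<open>x\<close> on permutation diagrams leaves coefficients on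
  the other diagrams only, and these have at most \<open>n - 2\<close> propagating lines by
  \<open>perm_diagram_or_propagating_le\<close>.\<close>

lemma brauer_decomposition:
  assumes "x \<in> carrier (brauer_algebra n \<delta>)"
  obtains y where "y \<in> brauer_ideal n (n - 2)"
    "x = (\<lambda>d. left_act n (\<lambda>\<sigma>. x (perm_diagram n \<sigma>)) (one_diagram n) d + y d)"
proof
  let ?x0 = "left_act n (\<lambda>\<sigma>. x (perm_diagram n \<sigma>)) (one_diagram n)"
  let ?y = "\<lambda>d. x d - ?x0 d"
  show "x = (\<lambda>d. ?x0 d + ?y d)"
    by simp
  show "?y \<in> brauer_ideal n (n - 2)"
    unfolding brauer_ideal_def
  proof (intro CollectI allI impI)
    fix d assume y: "?y d \<noteq> 0"
    have notperm: "\<not> (\<exists>\<sigma>\<in>perms n. d = perm_diagram n \<sigma>)"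
      using y left_act_one_perm[where x = "\<lambda>\<sigma>. x (perm_diagram n \<sigma>)"] by fastforce
    then have "?x0 d = 0"
      by (intro left_act_one_outside) blast
    with y assms have "d \<in> diagrams n n"
      by (auto simp: brauer_algebra_simps)
    with notperm show "d \<in> diagrams n n \<and> propagating d \<le> n - 2"
      using perm_diagram_or_propagating_le[of d n] by blast
  qed
qed

section \<open>The corner cut out by the splitting idempotent\<close>

locale splitting =
  fixes n :: nat and \<delta> :: "'k::field_char_0" and \<psi> :: "diagram \<Rightarrow> 'k"
  assumes n_ge_2: "n \<ge> 2" and splitting: "splitting_idempotent n \<delta> (n - 2) \<psi>"
begin

abbreviation J :: "(diagram \<Rightarrow> 'k) set" where "J \<equiv> brauer_ideal n (n - 2)"
abbreviation mult (infixl \<open>\<odot>\<close> 70) where "x \<odot> y \<equiv> brauer_mult n \<delta> x y"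

lemma kills: "x \<in> J \<Longrightarrow> \<psi> \<odot> x = (\<lambda>_. 0)" "x \<in> J \<Longrightarrow> x \<odot> \<psi> = (\<lambda>_. 0)"
  using splitting by (simp_all add: splitting_idempotent_def brauer_algebra_simps Let_def)

lemma one_outside: "d \<notin> diagrams n n \<Longrightarrow> one_diagram n d = (0::'k)"
  using identity_diagram(1)[of n] by (auto simp: one_diagram_def single_def)

lemma splitting_decomposition:
  obtains j where "j \<in> J" "\<psi> = (\<lambda>d. one_diagram n d + j d)"
proof
  have "one_diagram n \<in> carrier (brauer_algebra n \<delta>)"
    by (simp add: brauer_algebra_simps one_outside)
  then show "(\<lambda>d. \<psi> d - one_diagram n d) \<in> J"
    using splitting
    by (simp add: splitting_idempotent_def Let_def brauer_algebra_minus brauer_algebra_simps(3))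
qed simp

lemma \<psi>_outside: "d \<notin> diagrams n n \<Longrightarrow> \<psi> d = 0"
  using splitting by (simp add: splitting_idempotent_def brauer_algebra_simps Let_def)

text \<open>Here \<open>-j\<close> is the unit of the ideal, so both actions of \<open>x\<close> on \<open>j\<close> can be read off from \<open>j x j\<close>.\<close>

lemma right_act_\<psi>: "right_act n x \<psi> = left_act n x \<psi>"
proof -
  obtain j where j: "j \<in> J" "\<psi> = (\<lambda>d. one_diagram n d + j d)"
    using splitting_decomposition .
  have left: "left_act n x j d + (j \<odot> left_act n x j) d = 0" for d
    using fun_cong[OF kills(1)[OF brauer_ideal_left_act[OF j(1)]]] brauer_ideal_outside[OF brauer_ideal_left_act[OF j(1)]]
    by (simp add: j(2) brauer_mult_add_left brauer_mult_one_left)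
  have right: "right_act n x j d + (right_act n x j \<odot> j) d = 0" for d
    using fun_cong[OF kills(2)[OF brauer_ideal_right_act[OF j(1)]]] brauer_ideal_outside[OF brauer_ideal_right_act[OF j(1)]]
    by (simp add: j(2) brauer_mult_add_right brauer_mult_one_right)
  have "right_act n x j d = left_act n x j d" for d
    using left[of d] right[of d] unfolding brauer_mult_middle by (simp add: add_eq_0_iff2)
  then show ?thesis
    by (simp add: j(2) right_act_add lin_act_add right_act_one)
qed

lemma left_act_outside:
  assumes "\<And>d. d \<notin> diagrams n n \<Longrightarrow> v d = 0" "d \<notin> diagrams n n"
  shows "left_act n x v d = 0"
proof -
  have "relabel_top (inv \<sigma>) d \<notin> diagrams n n" if "\<sigma> \<in> perms n" for \<sigma>
    using relabel_top_diagrams(1)[OF that, of "relabel_top (inv \<sigma>) d"] assms(2) perms_bij[OF that] by auto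
  then show ?thesis
    using assms(1) by (simp add: lin_act_def)
qed

lemma mult_embedding_left: "x \<in> carrier (brauer_algebra n \<delta>) \<Longrightarrow> left_act n y (one_diagram n) \<odot> x = left_act n y x"
  by (simp add: brauer_mult_left_act brauer_mult_one_left brauer_algebra_simps)

lemma mult_embedding_right: "x \<in> carrier (brauer_algebra n \<delta>) \<Longrightarrow> x \<odot> left_act n y (one_diagram n) = right_act n y x"
  by (simp add: right_act_one[symmetric] brauer_mult_right_act brauer_mult_one_right brauer_algebra_simps)

lemma \<psi>_carrier: "\<psi> \<in> carrier (brauer_algebra n \<delta>)"
  by (simp add: brauer_algebra_simps \<psi>_outside)

lemma left_act_carrier: "v \<in> carrier (brauer_algebra n \<delta>) \<Longrightarrow> left_act n x v \<in> carrier (brauer_algebra n \<delta>)"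
  unfolding brauer_algebra_simps(1) using left_act_outside by blast

lemma left_act_conv: "left_act n x (left_act n y v) = left_act n (conv n x y) v"
  by (rule lin_act_conv[symmetric]) (rule relabel_top_comp)

text \<open>\<open>\<psi>\<close> annihilates the part of \<open>x\<close> in the ideal, so only the
  coefficients of \<open>x\<close> on permutation diagrams survive. On these the product is
  convolution, because \<open>\<psi>\<close> commutes with permutations.\<close>

lemma corner_mult:
  assumes x: "x \<in> carrier (brauer_algebra n \<delta>)"
  shows "left_act n e \<psi> \<odot> x = left_act n (conv n e (\<lambda>\<sigma>. x (perm_diagram n \<sigma>))) \<psi>" (is "?l")
    and "x \<odot> left_act n e \<psi> = left_act n (conv n (\<lambda>\<sigma>. x (perm_diagram n \<sigma>)) e) \<psi>" (is "?r")
proof -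
  let ?x0 = "\<lambda>\<sigma>. x (perm_diagram n \<sigma>)"
  obtain y where y: "y \<in> J" "x = (\<lambda>d. left_act n ?x0 (one_diagram n) d + y d)"
    using brauer_decomposition[OF x] .
  note G = left_act_carrier[OF \<psi>_carrier, of e]
  have "left_act n e \<psi> \<odot> y = (\<lambda>_. 0)"
    by (simp add: brauer_mult_left_act kills y lin_act_zero)
  moreover have "left_act n e \<psi> \<odot> left_act n ?x0 (one_diagram n) = left_act n (conv n e ?x0) \<psi>"
    unfolding mult_embedding_right[OF G] right_left_act right_act_\<psi> left_act_conv ..
  moreover have "left_act n e \<psi> \<odot> x =
      (\<lambda>d. (left_act n e \<psi> \<odot> left_act n ?x0 (one_diagram n)) d + (left_act n e \<psi> \<odot> y) d)"
    by (subst y(2)) (rule brauer_mult_add_right)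
  ultimately show ?l
    by simp
  \<comment> \<open>On this side \<open>e\<close> has to be moved behind \<open>\<psi>\<close>
    first, so that \<open>y\<close> meets \<open>\<psi>\<close> directly.\<close>
  have "y \<odot> left_act n e \<psi> = (\<lambda>_. 0)"
    by (simp add: right_act_\<psi>[symmetric] brauer_mult_right_act kills y right_act_zero)
  moreover have "left_act n ?x0 (one_diagram n) \<odot> left_act n e \<psi> = left_act n (conv n ?x0 e) \<psi>"
    unfolding mult_embedding_left[OF G] left_act_conv ..
  moreover have "x \<odot> left_act n e \<psi> =
      (\<lambda>d. (left_act n ?x0 (one_diagram n) \<odot> left_act n e \<psi>) d + (y \<odot> left_act n e \<psi>) d)"
    by (subst y(2)) (rule brauer_mult_add_left)
  ultimately show ?r
    by simp
qed

text \<open>\<open>\<psi>\<close> is the unit modulo the ideal, and elements of the ideal have no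
  coefficients on permutation diagrams. So the corner element remembers \<open>e\<close>, and in
  particular is nonzero when \<open>e\<close> is.\<close>

lemma left_act_\<psi>_perm:
  assumes "\<sigma> \<in> perms n"
  shows "left_act n e \<psi> (perm_diagram n \<sigma>) = e \<sigma>"
proof -
  obtain j where j: "j \<in> J" "\<psi> = (\<lambda>d. one_diagram n d + j d)"
    using splitting_decomposition .
  show ?thesis
    by (simp add: j(2) lin_act_add left_act_one_perm assms
        brauer_ideal_perm[OF brauer_ideal_left_act[OF j(1)] n_ge_2])
qed

lemma central_idempotent_corner:
  assumes "class_fun n e" "conv n e e = e"
  shows "central_idempotent (brauer_algebra n \<delta>) (left_act n e \<psi>)"
  unfolding central_idempotent_def
proof (intro conjI ballI)
  show G: "left_act n e \<psi> \<in> carrier (brauer_algebra n \<delta>)"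
    by (rule left_act_carrier[OF \<psi>_carrier])
  have "left_act n (conv n e (\<lambda>\<sigma>. left_act n e \<psi> (perm_diagram n \<sigma>))) \<psi> = left_act n (conv n (\<lambda>\<sigma>. left_act n e \<psi> (perm_diagram n \<sigma>)) e) \<psi>"
    by (rule lin_act_cong) (rule conv_class_fun_commute[OF assms(1)])
  also have "conv n (\<lambda>\<sigma>. left_act n e \<psi> (perm_diagram n \<sigma>)) e = conv n e e"
    by (rule lin_act_cong) (rule left_act_\<psi>_perm)
  also have "conv n e e = e"
    by (rule assms(2))
  finally show "left_act n e \<psi> \<otimes>\<^bsub>brauer_algebra n \<delta>\<^esub> left_act n e \<psi> = left_act n e \<psi>"
    unfolding brauer_algebra_simps corner_mult(1)[OF G] .
  fix x assume x: "x \<in> carrier (brauer_algebra n \<delta>)"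
  show "left_act n e \<psi> \<otimes>\<^bsub>brauer_algebra n \<delta>\<^esub> x = x \<otimes>\<^bsub>brauer_algebra n \<delta>\<^esub> left_act n e \<psi>"
    unfolding brauer_algebra_simps corner_mult[OF x]
    by (rule lin_act_cong) (rule conv_class_fun_commute[OF assms(1)])
qed

text \<open>Commuting with the diagram of \<open>inv \<tau>\<close> equates the coefficients of
  \<open>\<phi>\<close> after relabelling the bottom row by \<open>inv \<tau>\<close> and the top
  row by \<open>\<tau>\<close>. On the diagram of \<open>\<sigma>\<close> these relabellings give
  \<open>\<sigma> \<circ> \<tau>\<close> and \<open>\<tau> \<circ> \<sigma>\<close>.\<close>

lemma central_class_fun:
  assumes "central_idempotent (brauer_algebra n \<delta>) \<phi>"
  shows "class_fun n (\<lambda>\<sigma>. \<phi> (perm_diagram n \<sigma>))"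
  unfolding class_fun_def
proof (intro ballI)
  fix \<sigma> \<tau> assume p: "\<sigma> \<in> perms n" "\<tau> \<in> perms n"
  define s :: "(nat \<Rightarrow> nat) \<Rightarrow> 'k" where "s = single (inv \<tau>)"
  have \<phi>: "\<phi> \<in> carrier (brauer_algebra n \<delta>)"
    using assms by (simp add: central_idempotent_def)
  have "left_act n s (one_diagram n) \<in> carrier (brauer_algebra n \<delta>)"
    by (rule left_act_carrier) (simp add: brauer_algebra_simps one_outside)
  then have "\<phi> \<odot> left_act n s (one_diagram n) = left_act n s (one_diagram n) \<odot> \<phi>"
    using assms unfolding central_idempotent_def brauer_algebra_simps(2) by blast
  then have eq: "right_act n s \<phi> = left_act n s \<phi>"
    unfolding mult_embedding_left[OF \<phi>] mult_embedding_right[OF \<phi>] .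
  have "right_act n s \<phi> d = \<phi> (relabel_bottom (inv \<tau>) d)" "left_act n s \<phi> d = \<phi> (relabel_top \<tau> d)" for d
    using p by (simp_all add: right_act_def lin_act_def s_def single_def if_distrib[of "\<lambda>x. x * _"] cong: if_cong)
  with fun_cong[OF eq, of "perm_diagram n \<sigma>"]
  show "\<phi> (perm_diagram n (\<sigma> \<circ> \<tau>)) = \<phi> (perm_diagram n (\<tau> \<circ> \<sigma>))"
    using p by (simp add: relabel_top_perm_diagram relabel_bottom_perm_diagram)
qed

lemma primitive_eq_corner:
  assumes prim: "primitive_central_idempotent (brauer_algebra n \<delta>) \<phi>"
    and e: "class_fun n e" "conv n e e = e" "\<sigma> \<in> perms n" "e \<sigma> \<noteq> 0"
    and fe: "conv n (\<lambda>\<sigma>. \<phi> (perm_diagram n \<sigma>)) e = e"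
  shows "\<phi> = left_act n e \<psi>"
proof -
  let ?B = "brauer_algebra n \<delta>"
  define G where "G = left_act n e \<psi>"
  define h where "h = (\<lambda>d. \<phi> d - G d)"
  have \<phi>: "central_idempotent ?B \<phi>"
    using prim by (simp add: primitive_central_idempotent_def)
  have G: "central_idempotent ?B G"
    unfolding G_def by (rule central_idempotent_corner[OF e(1,2)])
  have \<phi>': "\<phi> \<in> carrier ?B" "\<phi> \<odot> \<phi> = \<phi>" "\<And>x. x \<in> carrier ?B \<Longrightarrow> \<phi> \<odot> x = x \<odot> \<phi>"
    and G': "G \<in> carrier ?B" "G \<odot> G = G" "\<And>x. x \<in> carrier ?B \<Longrightarrow> G \<odot> x = x \<odot> G"
    using \<phi> G by (simp_all add: central_idempotent_def brauer_algebra_simps(2))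
  \<comment> \<open>By \<open>corner_mult\<close> the product depends on \<open>\<phi>\<close> only
    through its coefficients on permutation diagrams, which is where \<open>fe\<close>
    enters.\<close>
  have \<phi>G: "\<phi> \<odot> G = G"
    unfolding G_def corner_mult(2)[OF \<phi>'(1)] fe ..
  then have G\<phi>: "G \<odot> \<phi> = G"
    using G'(3)[OF \<phi>'(1)] by simp
  have h: "h \<in> carrier ?B"
    using \<phi>'(1) G'(1) by (simp add: h_def brauer_algebra_simps(1))
  have "h \<odot> h = h"
    unfolding h_def brauer_mult_diff_left brauer_mult_diff_right by (simp add: \<phi>'(2) G'(2) \<phi>G G\<phi>)
  moreover have "h \<odot> x = x \<odot> h" if "x \<in> carrier ?B" for x
    unfolding h_def brauer_mult_diff_left brauer_mult_diff_right using that by (simp only: \<phi>'(3) G'(3))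
  ultimately have "central_idempotent ?B h"
    unfolding central_idempotent_def brauer_algebra_simps(2) using h by blast
  moreover have "G \<otimes>\<^bsub>?B\<^esub> h = \<zero>\<^bsub>?B\<^esub>"
    unfolding h_def brauer_algebra_simps(2,4) brauer_mult_diff_right by (simp add: G'(2) G\<phi>)
  moreover have "\<phi> = G \<oplus>\<^bsub>?B\<^esub> h"
    by (simp add: brauer_algebra_simps h_def)
  ultimately have "G = \<zero>\<^bsub>?B\<^esub> \<or> h = \<zero>\<^bsub>?B\<^esub>"
    using prim G unfolding primitive_central_idempotent_def by blast
  moreover have "G \<noteq> \<zero>\<^bsub>?B\<^esub>"
    using left_act_\<psi>_perm[OF e(3), of e] e(4) by (auto simp: G_def brauer_algebra_simps dest: fun_cong)
  ultimately show ?thesis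
    by (auto simp: h_def G_def brauer_algebra_simps fun_eq_iff)
qed

end

section \<open>The cell module of a partition of \<open>n\<close>\<close>

lemma cell_basis_eq:
  assumes "n \<ge> 2"
  shows "cell_basis n n = perm_diagram n ` perms n"
  using perm_diagram_or_propagating_le[of _ n] perm_diagram_diagrams[of _ n] assms
  by (fastforce simp: cell_basis_def)

text \<open>The cell module of a partition of \<open>n\<close> is the Specht module: \<open>d \<otimes> v \<mapsto> \<sigma> v\<close> for the diagram
  \<open>d\<close> of \<open>\<sigma>\<close>.\<close>

definition cell_to_specht ::
    "nat \<Rightarrow> (diagram \<Rightarrow> tabloid \<Rightarrow> 'k::field) \<Rightarrow> tabloid \<Rightarrow> 'k" where
  "cell_to_specht n u = (\<lambda>T. \<Sum>\<sigma>\<in>perms n. perm_act \<sigma> (u (perm_diagram n \<sigma>)) T)"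

lemma cell_to_specht_pure_tensor:
  assumes "\<sigma> \<in> perms n"
  shows "cell_to_specht n (pure_tensor (perm_diagram n \<sigma>) v) = perm_act \<sigma> v"
proof
  fix T
  have "perm_act \<tau> (pure_tensor (perm_diagram n \<sigma>) v (perm_diagram n \<tau>)) T =
      (if \<tau> = \<sigma> then perm_act \<sigma> v T else 0)" if "\<tau> \<in> perms n" for \<tau>
    using inj_on_eq_iff[OF inj_on_perm_diagram that assms] by (simp add: pure_tensor_def perm_act_def)
  then show "cell_to_specht n (pure_tensor (perm_diagram n \<sigma>) v) T = perm_act \<sigma> v T"
    using assms by (simp add: cell_to_specht_def)
qed

lemma cell_to_specht_diff:
  "cell_to_specht n (u - w) T = cell_to_specht n u T - cell_to_specht n w T"
  by (simp add: cell_to_specht_def perm_act_def sum_subtractf)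

text \<open>On a generator with \<open>d\<close> the diagram of \<open>\<tau>\<close>, both terms
  are sent to the image of \<open>v\<close> under \<open>\<tau> \<circ> \<sigma>\<close>. The kernel
  is a subspace, so it contains the span.\<close>

lemma cell_to_specht_relations:
  assumes "n \<ge> 2" "sum_list \<mu> = n" "u \<in> cell_relations n \<mu>"
  shows "cell_to_specht n u = (\<lambda>_. 0 :: 'k::field)"
proof -
  interpret module "\<lambda>(c::'k) u (d::diagram) (T::tabloid). c * u d T"
    by unfold_locales (auto simp: fun_eq_iff algebra_simps)
  let ?W = "{u. cell_to_specht n u = (\<lambda>_. 0 :: 'k)}"
  have "subspace ?W"
    by (rule subspaceI)
       (auto simp: cell_to_specht_def perm_act_def fun_eq_iff sum.distrib sum_distrib_left[symmetric])
  moreover have "pure_tensor (compose_diagrams d (perm_diagram n \<sigma>)) v - pure_tensor d (perm_act \<sigma> v) \<in> ?W"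
    if d: "d \<in> cell_basis n n" and s: "\<sigma> permutes {1..n}" for d \<sigma> and v :: "tabloid \<Rightarrow> 'k"
  proof -
    obtain \<tau> where t: "\<tau> \<in> perms n" "d = perm_diagram n \<tau>"
      using d cell_basis_eq[OF assms(1)] by auto
    have s: "\<sigma> \<in> perms n"
      using s by (simp add: perms_def)
    have "compose_diagrams d (perm_diagram n \<sigma>) = perm_diagram n (\<tau> \<circ> \<sigma>)"
      unfolding t(2) compose_perm_left(2)[OF t(1) perm_diagram_diagrams(1)[OF s]]
      by (rule relabel_top_perm_diagram)
    then show ?thesis
      using s t by (simp add: fun_eq_iff cell_to_specht_diff cell_to_specht_pure_tensor)
        (simp add: perm_act_def vimage_comp)
  qed
  ultimately have "cell_relations n \<mu> \<subseteq> ?W"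
    unfolding cell_relations_def assms(2) by (intro span_minimal) auto
  with assms(3) show ?thesis
    by blast
qed

text \<open>The hypothesis on \<open>\<phi>\<close> is applied to the tensor of the identity diagram
  with the polytabloid. There \<open>\<phi>\<close> produces the coefficient \<open>\<phi> c\<close>
  at each basis diagram \<open>c\<close>, and \<open>cell_to_specht\<close> turns this family into
  the group algebra action while it kills the error term in \<open>cell_relations\<close>.\<close>

lemma (in young_tableau) cell_idempotent_fixes_polytabloid:
  fixes \<phi> :: "diagram \<Rightarrow> 'k::field"
  assumes n: "n \<ge> 2" and \<phi>: "cell_idempotent n \<delta> \<mu> \<phi>"
  shows "group_algebra_act n (\<lambda>\<sigma>. \<phi> (perm_diagram n \<sigma>)) (polytabloid \<mu> t) = polytabloid \<mu> t"
proof -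
  interpret specht: module "\<lambda>(c::'k) v (T::tabloid). c * v T"
    by unfold_locales (auto simp: fun_eq_iff algebra_simps)
  let ?v = "polytabloid \<mu> t :: tabloid \<Rightarrow> 'k"
  define u where "u = pure_tensor (perm_diagram n id) ?v"
  have id: "perm_diagram n id \<in> cell_basis n n"
    by (simp add: cell_basis_def identity_diagram)
  have fin: "finite (cell_basis n n)"
    by (simp add: cell_basis_def finite_diagrams)
  have "0 \<in> (specht \<mu> :: (tabloid \<Rightarrow> 'k) set)"
    unfolding specht_def by (rule specht.span_zero)
  then have "u \<in> cell_space n \<mu>"
    using id polytabloid_in_specht by (auto simp: cell_space_def sum_list_eq u_def pure_tensor_def)
  then have "cell_act n \<delta> \<mu> \<phi> u - u \<in> cell_relations n \<mu>"
    using \<phi> by (simp add: cell_idempotent_def)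
  then have zero: "cell_to_specht n (cell_act n \<delta> \<mu> \<phi> u - u) = (\<lambda>_. 0)"
    by (rule cell_to_specht_relations[OF n sum_list_eq])
  have "cell_act n \<delta> \<mu> \<phi> u c T = \<phi> c * ?v T" if c: "c \<in> cell_basis n n" for c T
  proof -
    have "(\<Sum>d\<in>cell_basis n n. if compose_diagrams b d = c then \<phi> b * \<delta> ^ loops b d * u d T else 0) =
        (if b = c then \<phi> c * ?v T else 0)" if b: "b \<in> diagrams n n" for b
    proof -
      have "(\<Sum>d\<in>cell_basis n n. if compose_diagrams b d = c then \<phi> b * \<delta> ^ loops b d * u d T else 0) =
          (\<Sum>d\<in>cell_basis n n. if d = perm_diagram n id then if b = c then \<phi> c * ?v T else 0 else 0)"
      proof (rule sum.cong[OF refl])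
        fix d
        show "(if compose_diagrams b d = c then \<phi> b * \<delta> ^ loops b d * u d T else 0) =
            (if d = perm_diagram n id then if b = c then \<phi> c * ?v T else 0 else 0)"
        proof (cases "d = perm_diagram n id")
          case True
          show ?thesis
            unfolding True compose_identity_right[OF b] by (simp add: u_def pure_tensor_def)
        qed (simp add: u_def pure_tensor_def)
      qed
      also have "\<dots> = (if b = c then \<phi> c * ?v T else 0)"
        using fin id by simp
      finally show ?thesis .
    qed
    then have "cell_act n \<delta> \<mu> \<phi> u c T = (\<Sum>b\<in>diagrams n n. if b = c then \<phi> c * ?v T else 0)"
      using c by (simp add: cell_act_def sum_list_eq)
    also have "\<dots> = \<phi> c * ?v T"
      using c by (simp add: finite_diagrams cell_basis_def)
    finally show ?thesis .
  qed
  then have "cell_to_specht n (cell_act n \<delta> \<mu> \<phi> u) = group_algebra_act n (\<lambda>\<sigma>. \<phi> (perm_diagram n \<sigma>)) ?v"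
    unfolding cell_to_specht_def group_algebra_act_def perms_def[symmetric]
    by (intro ext sum.cong refl) (simp add: perm_act_def cell_basis_eq[OF n])
  moreover have "cell_to_specht n u = ?v"
    unfolding u_def cell_to_specht_pure_tensor[OF perms_id] by (simp add: perm_act_def)
  ultimately show ?thesis
    using fun_cong[OF zero] by (simp add: fun_eq_iff cell_to_specht_diff)
qed

theorem lemma15:
  fixes n :: nat and \<delta> :: "'a::field_char_0" and \<nu> :: "nat list"
    and \<psi> \<phi> :: "diagram \<Rightarrow> 'a" and e :: "(nat \<Rightarrow> nat) \<Rightarrow> rat"
  assumes "n \<ge> 2"
    and "semisimple_ring (brauer_algebra n \<delta>)"
    and "\<nu> \<in> number_partitions n"
    and "splitting_idempotent n \<delta> (n - 2) \<psi>"
    and "specht_idempotent n \<nu> e"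
    and "cell_idempotent n \<delta> \<nu> \<phi>"
  shows "\<phi> = \<psi> \<otimes>\<^bsub>brauer_algebra n \<delta>\<^esub> embed_perms n e"
proof -
  interpret splitting n \<delta> \<psi>
    using assms by unfold_locales
  obtain t where "t \<in> tableaux \<nu>"
    using tableaux_nonempty .
  then interpret young_tableau \<nu> t n
    using assms by unfold_locales
  define e' :: "(nat \<Rightarrow> nat) \<Rightarrow> 'a" where "e' = (\<lambda>\<sigma>. of_rat (e \<sigma>))"
  have prim: "primitive_central_idempotent (symmetric_group_algebra n) e"
    using assms(5) by (simp add: specht_idempotent_def)
  then have e: "conv n e e = e" "class_fun n e" "\<forall>\<sigma>. \<sigma> \<notin> perms n \<longrightarrow> e \<sigma> = 0"
    by (auto simp: primitive_central_idempotent_def central_idempotent_symmetric_group_algebra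
        carrier_symmetric_group_algebra)
  have "e \<noteq> (\<lambda>_. 0)"
    using prim by (simp add: primitive_central_idempotent_def symmetric_group_algebra_def twisted_algebra_def)
  \<comment> \<open>Outside \<open>perms n\<close> the function \<open>e\<close> vanishes, so a
    nonzero value sits at a permutation.\<close>
  then obtain \<sigma> where \<sigma>: "\<sigma> \<in> perms n" "e' \<sigma> \<noteq> 0"
    using e(3) by (auto simp: e'_def fun_eq_iff)
  have e'_class: "class_fun n e'"
    using e(2) unfolding class_fun_def e'_def by metis
  have e'_idem: "conv n e' e' = e'"
  proof
    fix \<sigma>
    show "conv n e' e' \<sigma> = e' \<sigma>"
      using of_rat_conv[of n e e \<sigma>, where 'k = 'a] unfolding e(1) e'_def by (rule sym)
  qed
  have \<phi>: "primitive_central_idempotent (brauer_algebra n \<delta>) \<phi>"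
    using assms(6) by (simp add: cell_idempotent_def)
  then have f: "class_fun n (\<lambda>\<sigma>. \<phi> (perm_diagram n \<sigma>))"
    by (intro central_class_fun) (simp add: primitive_central_idempotent_def)
  have "conv n (\<lambda>\<sigma>. \<phi> (perm_diagram n \<sigma>)) e' = e'"
    unfolding e'_def
    by (rule conv_specht_idempotent[OF assms(5) f cell_idempotent_fixes_polytabloid[OF assms(1,6)]])
  from primitive_eq_corner[OF \<phi> e'_class e'_idem \<sigma> this] have "\<phi> = left_act n e' \<psi>" .
  also have "\<dots> = \<psi> \<otimes>\<^bsub>brauer_algebra n \<delta>\<^esub> embed_perms n e"
    \<comment> \<open>Multiplying \<open>\<psi>\<close> by \<open>e\<close> from the right is the
      right action, which on \<open>\<psi>\<close> agrees with the left one.\<close>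
    unfolding brauer_algebra_simps(2) embed_perms_eq e'_def[symmetric] mult_embedding_right[OF \<psi>_carrier]
    by (simp add: right_act_\<psi>)
  finally show ?thesis .
qed

end
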